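(* Let $p$ be an odd prime, $K$ an algebraically closed field of characteristic $\ne p$, $G=\mathrm{PGL}_n(K)$, $n=p^st$ with $\gcd(p,t)=1$, $s,t\ge1$. Let $1\le r\le s$, $n=p^rk$, and $D=D_r\times(H\otimes I_{p^r})$ where $H$ is trivial or a toral elementary abelian $p$-subgroup of $\mathrm{PGL}_k(K)$ with connected centralizer in $\mathrm{PGL}_k(K)$. Then $C_G(D)=\langle C_G(D)^\circ,\bar B_0,\dots,\bar B_{r-1}\rangle=C_G(D)^\circ\cdot B_r$.
   Context: Fix a primitive $p$-th root of unity $\beta\in K$. For $0\le s'\le r-1$: $\sigma_{s'}$ is the permutation of $\{1,\dots,p^r\}$ with $\sigma_{s'}(i)=i+p^{s'}$ if $i\equiv1,\dots,(p-1)p^{s'}\pmod{p^{s'+1}}$ and $\sigma_{s'}(i)=i-(p-1)p^{s'}$ otherwise (residues in $\{1,\dots,p^{s'+1}\}$); $A_{s'}$ is diagonal $p^r\times p^r$ with $(A_{s'})_{ii}=\beta^{\lfloor(i-1)/p^{s'}\rfloor}$; $B_{s'}$ is the permutation matrix with $(B_{s'})_{ij}=1$ iff $\sigma_{s'}(i)=j$. $\bar A_{s'},\bar B_{s'}$ are the images in $\mathrm{PGL}_n(K)$ of $I_k\otimes A_{s'}$, $I_k\otimes B_{s'}$. $D_r=\langle\bar A_0,\dots,\bar A_{r-1}\rangle$, $B_r=\langle\bar B_0,\dots,\bar B_{r-1}\rangle$. $H\otimes I_{p^r}$ is the image of $\{h\otimes I_{p^r}\}$. Toral: in a maximal torus.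 *)

theory Defs
  imports "HOL-Analysis.Analysis" "HOL-Computational_Algebra.Polynomial"
    "Jordan_Normal_Form.Determinant"
begin

text \<open>Matrices are Jordan_Normal_Form matrices, indices are 0-based.
  An element of PGL_n(K) is represented as the class of an invertible matrix
  modulo nonzero scalars, i.e. as the set of all its nonzero scalar multiples.\<close>

definition GLm :: "nat \<Rightarrow> 'a::field mat set" where
  "GLm n = {A \<in> carrier_mat n n. det A \<noteq> 0}"

definition pcls :: "'a::field mat \<Rightarrow> 'a mat set" where
  "pcls A = {c \<cdot>\<^sub>m A | c. c \<noteq> 0}"

definition PGLm :: "nat \<Rightarrow> 'a::field mat set set" where
  "PGLm n = pcls ` GLm n"

definition pmul :: "'a::field mat set \<Rightarrow> 'a mat set \<Rightarrow> 'a mat set" where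
  "pmul X Y = {A * B | A B. A \<in> X \<and> B \<in> Y}"

definition pone :: "nat \<Rightarrow> 'a::field mat set" where
  "pone n = pcls (1\<^sub>m n)"

definition pinv :: "nat \<Rightarrow> 'a::field mat set \<Rightarrow> 'a mat set" where
  "pinv n X = {B \<in> carrier_mat n n. \<exists>A \<in> X. A * B = 1\<^sub>m n}"

fun ppow :: "nat \<Rightarrow> 'a::field mat set \<Rightarrow> nat \<Rightarrow> 'a mat set" where
  "ppow n X 0 = pone n"
| "ppow n X (Suc m) = pmul (ppow n X m) X"

inductive_set pgen :: "nat \<Rightarrow> 'a::field mat set set \<Rightarrow> 'a mat set set"
  for n S where
  gen_one: "pone n \<in> pgen n S"
| gen_base: "X \<in> S \<Longrightarrow> X \<in> pgen n S"
| gen_mul: "X \<in> pgen n S \<Longrightarrow> Y \<in> pgen n S \<Longrightarrow> pmul X Y \<in> pgen n S"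
| gen_inv: "X \<in> pgen n S \<Longrightarrow> pinv n X \<in> pgen n S"

definition psubgroup :: "nat \<Rightarrow> 'a::field mat set set \<Rightarrow> bool" where
  "psubgroup n H \<longleftrightarrow> H \<subseteq> PGLm n \<and> pone n \<in> H \<and>
     (\<forall>X\<in>H. \<forall>Y\<in>H. pmul X Y \<in> H) \<and> (\<forall>X\<in>H. pinv n X \<in> H)"

definition pcentralizer :: "nat \<Rightarrow> 'a::field mat set set \<Rightarrow> 'a mat set set" where
  "pcentralizer n D = {G \<in> PGLm n. \<forall>X\<in>D. pmul G X = pmul X G}"

definition psetmul :: "'a::field mat set set \<Rightarrow> 'a mat set set \<Rightarrow> 'a mat set set" where
  "psetmul S T = {pmul X Y | X Y. X \<in> S \<and> Y \<in> T}"

inductive_set polyfun :: "nat \<Rightarrow> ('a::field mat \<Rightarrow> 'a) set" for n where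
  pf_const: "(\<lambda>A. c) \<in> polyfun n"
| pf_entry: "i < n \<Longrightarrow> j < n \<Longrightarrow> (\<lambda>A. A $$ (i, j)) \<in> polyfun n"
| pf_add: "f \<in> polyfun n \<Longrightarrow> g \<in> polyfun n \<Longrightarrow> (\<lambda>A. f A + g A) \<in> polyfun n"
| pf_mul: "f \<in> polyfun n \<Longrightarrow> g \<in> polyfun n \<Longrightarrow> (\<lambda>A. f A * g A) \<in> polyfun n"

definition gl_zariski :: "nat \<Rightarrow> 'a::field mat topology" where
  "gl_zariski n = topology (\<lambda>U. U \<subseteq> GLm n \<and>
     (\<exists>F \<subseteq> polyfun n. GLm n - U = {A \<in> GLm n. \<forall>f\<in>F. f A = 0}))"

text \<open>Zariski topology on PGL_n(K): quotient topology of GL_n(K) -> PGL_n(K)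
  (the preimage of a set U of classes is the union of U).\<close>
definition pgl_zariski :: "nat \<Rightarrow> 'a::field mat set topology" where
  "pgl_zariski n = topology (\<lambda>U. U \<subseteq> PGLm n \<and> openin (gl_zariski n) (\<Union>U))"

definition pidcomp :: "nat \<Rightarrow> 'a::field mat set set \<Rightarrow> 'a mat set set" where
  "pidcomp n C = connected_component_of_set (subtopology (pgl_zariski n) C) (pone n)"

text \<open>Toral: contained in a maximal torus; the maximal tori of PGL_k(K) are the
  conjugates of the image of the diagonal invertible matrices.\<close>
definition diag_mat :: "'a::zero mat \<Rightarrow> bool" where
  "diag_mat A \<longleftrightarrow> (\<forall>i j. i < dim_row A \<longrightarrow> j < dim_col A \<longrightarrow> i \<noteq> j \<longrightarrow> A $$ (i, j) = 0)"

definition ptoral :: "nat \<Rightarrow> 'a::field mat set set \<Rightarrow> bool" where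
  "ptoral k H \<longleftrightarrow> (\<exists>g g'. g \<in> carrier_mat k k \<and> g' \<in> carrier_mat k k \<and> g * g' = 1\<^sub>m k \<and>
      H \<subseteq> {pcls (g * Dm * g') | Dm. Dm \<in> GLm k \<and> diag_mat Dm})"

definition elem_abelian_p :: "nat \<Rightarrow> nat \<Rightarrow> 'a::field mat set set \<Rightarrow> bool" where
  "elem_abelian_p p k H \<longleftrightarrow> psubgroup k H \<and> finite H \<and>
     (\<forall>X\<in>H. \<forall>Y\<in>H. pmul X Y = pmul Y X) \<and> (\<forall>X\<in>H. ppow k X p = pone k)"

definition kron :: "'a::times mat \<Rightarrow> 'a mat \<Rightarrow> 'a mat" where
  "kron A B = mat (dim_row A * dim_row B) (dim_col A * dim_col B)
     (\<lambda>(i, j). A $$ (i div dim_row B, j div dim_col B) * B $$ (i mod dim_row B, j mod dim_col B))"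

definition Amat :: "nat \<Rightarrow> nat \<Rightarrow> 'a::field \<Rightarrow> nat \<Rightarrow> 'a mat" where
  "Amat p r \<beta> s' = mat (p ^ r) (p ^ r) (\<lambda>(i, j). if i = j then \<beta> ^ (i div p ^ s') else 0)"

definition sigma_perm :: "nat \<Rightarrow> nat \<Rightarrow> nat \<Rightarrow> nat" where
  "sigma_perm p s' i = (if i mod p ^ (s' + 1) < (p - 1) * p ^ s' then i + p ^ s'
                         else i - (p - 1) * p ^ s')"

definition Bmat :: "nat \<Rightarrow> nat \<Rightarrow> nat \<Rightarrow> 'a::field mat" where
  "Bmat p r s' = mat (p ^ r) (p ^ r) (\<lambda>(i, j). if sigma_perm p s' i = j then 1 else 0)"

definition Abar :: "nat \<Rightarrow> nat \<Rightarrow> nat \<Rightarrow> 'a::field \<Rightarrow> nat \<Rightarrow> 'a mat set" where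
  "Abar p r k \<beta> s' = pcls (kron (1\<^sub>m k) (Amat p r \<beta> s'))"

definition Bbar :: "nat \<Rightarrow> nat \<Rightarrow> nat \<Rightarrow> nat \<Rightarrow> 'a::field mat set" where
  "Bbar p r k s' = pcls (kron (1\<^sub>m k) (Bmat p r s'))"

definition tensorI :: "nat \<Rightarrow> 'a::field mat set \<Rightarrow> 'a mat set" where
  "tensorI q X = pcls (kron (SOME h. h \<in> X) (1\<^sub>m q))"

end

theory Submission
  imports Defs
begin

text \<open>Let the class of g centralize D. Each $B_j$ commutes with $H \otimes I$ and with every
  $A_s$ except $A_j$, with which it commutes up to the scalar $\beta$; so after multiplying g by an
  element of $B_r$ we may assume that g commutes exactly with all $A_s$, that is, g is block
  diagonal with respect to the residue of the index modulo $p^r$. The scalar by which g commutes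
  with $h \otimes I$ is then the one by which a single block commutes with h. That scalar is a
  root of unity, hence constant, hence 1, on the connected centralizer of H. So g commutes exactly
  with all generators of D, and the line joining 1 to g lies in the centralizer of D wherever it is
  invertible. An open subset of a line is connected, so g lies in the identity component.\<close>

subsection \<open>The group of matrix classes\<close>

text \<open>Centralizing in PGL only means commuting up to scalars, and a relation
  \<open>g x = c x g\<close> with c other than 1 is not inherited by the combinations of 1 and g.
  The line argument therefore needs every such c to be removed, and the two kinds of generators
  require different means. With \<open>A_s\<close> the scalar is a quotient of two diagonal entries
  of \<open>A_s\<close>, hence a power of \<open>\<beta>\<close>, and powers of \<open>B_s\<close>
  cancel exactly these. Elements of \<open>B_r\<close> cannot change the scalars with
  \<open>H\<close>, since they live in the other tensor factor; there connectedness has to help, and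
  it is a statement about k by k matrices, which is why a block must be extracted. One block is
  enough because \<open>h \<otimes> I\<close> acts in the same way on all of them. Block form itself
  comes from base-p digits: the diagonal entries of \<open>A_0\<close>, ..., \<open>A_(r-1)\<close>
  at an index determine all its digits modulo \<open>p ^ r\<close>, while \<open>B_s\<close> shifts
  digit s cyclically. Everything is tested on generators of D represented by matrices, where the
  scalars are visible.\<close>

lemma GLm_carrier: "A \<in> GLm n \<Longrightarrow> A \<in> carrier_mat n n"
  by (simp add: GLm_def)

lemma one_in_GLm: "1\<^sub>m n \<in> GLm n"
  by (simp add: GLm_def)

lemma mult_in_GLm: "A \<in> GLm n \<Longrightarrow> B \<in> GLm n \<Longrightarrow> A * B \<in> GLm n"
  by (auto simp: GLm_def det_mult)

lemma smult_in_GLm: "A \<in> GLm n \<Longrightarrow> c \<noteq> 0 \<Longrightarrow> c \<cdot>\<^sub>m A \<in> GLm n"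
  by (auto simp: GLm_def)

lemma right_inverse_in_GLm:
  fixes A :: "'a::field mat"
  assumes "A \<in> carrier_mat n n" "B \<in> carrier_mat n n" "A * B = 1\<^sub>m n"
  shows "A \<in> GLm n" "B \<in> GLm n"
proof -
  have "det A * det B = 1"
    using det_mult[OF assms(1,2)] assms(3) by simp
  then show "A \<in> GLm n" "B \<in> GLm n"
    using assms(1,2) by (auto simp: GLm_def)
qed

lemma GLm_inverse:
  fixes A :: "'a::field mat"
  assumes "A \<in> GLm n"
  obtains B where "B \<in> GLm n" "A * B = 1\<^sub>m n" "B * A = 1\<^sub>m n"
proof -
  have A: "A \<in> carrier_mat n n" "det A \<noteq> 0"
    using assms by (auto simp: GLm_def)
  have "A \<in> Units (ring_mat TYPE('a) n ())"
    by (rule det_non_zero_imp_unit[OF A])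
  then obtain B where B: "B \<in> carrier_mat n n" "A * B = 1\<^sub>m n" "B * A = 1\<^sub>m n"
    unfolding Units_def ring_mat_def by auto
  then show thesis
    using that right_inverse_in_GLm[OF A(1)] by blast
qed

lemma smult_smult_mat: "a \<cdot>\<^sub>m (b \<cdot>\<^sub>m (A :: 'a::semigroup_mult mat)) = (a * b) \<cdot>\<^sub>m A"
  by (intro eq_matI) (auto simp: mult.assoc)

lemma one_smult_mat: "(1 :: 'a::monoid_mult) \<cdot>\<^sub>m A = A"
  by (intro eq_matI) auto

lemma smult_mult_smult_mat:
  fixes A B :: "'a::field mat"
  assumes "A \<in> carrier_mat n n" "B \<in> carrier_mat n n"
  shows "(a \<cdot>\<^sub>m A) * (b \<cdot>\<^sub>m B) = (a * b) \<cdot>\<^sub>m (A * B)"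
  using assms
  by (simp add: mult_smult_distrib[of _ n n _ n] mult_smult_assoc_mat[of _ n n _ n] smult_smult_mat
      mult.commute)

lemma pcls_self: "A \<in> pcls A"
  unfolding pcls_def using one_smult_mat[of A] by (auto intro!: exI[of _ 1])

lemma pcls_smult:
  assumes "c \<noteq> 0"
  shows "pcls (c \<cdot>\<^sub>m A) = pcls A"
proof
  show "pcls (c \<cdot>\<^sub>m A) \<subseteq> pcls A"
    using assms by (auto simp: pcls_def smult_smult_mat)
  show "pcls A \<subseteq> pcls (c \<cdot>\<^sub>m A)"
  proof
    fix B assume "B \<in> pcls A"
    then obtain d where d: "d \<noteq> 0" "B = d \<cdot>\<^sub>m A" by (auto simp: pcls_def)
    then have "B = (d / c) \<cdot>\<^sub>m (c \<cdot>\<^sub>m A)" "d / c \<noteq> 0"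
      using assms by (auto simp: smult_smult_mat)
    then show "B \<in> pcls (c \<cdot>\<^sub>m A)" unfolding pcls_def by blast
  qed
qed

lemma pcls_eq_iff_mem: "pcls A = pcls B \<longleftrightarrow> A \<in> pcls B"
proof
  show "pcls A = pcls B \<Longrightarrow> A \<in> pcls B" using pcls_self by blast
  assume "A \<in> pcls B"
  then obtain c where "c \<noteq> 0" "A = c \<cdot>\<^sub>m B" by (auto simp: pcls_def)
  then show "pcls A = pcls B" using pcls_smult by blast
qed

lemma pcls_eq_iff: "pcls A = pcls B \<longleftrightarrow> (\<exists>c. c \<noteq> 0 \<and> A = c \<cdot>\<^sub>m B)"
  unfolding pcls_eq_iff_mem by (auto simp: pcls_def)

lemma pcls_in_PGLm: "A \<in> GLm n \<Longrightarrow> pcls A \<in> PGLm n"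
  by (simp add: PGLm_def)

lemma PGLm_E:
  assumes "X \<in> PGLm n"
  obtains A where "A \<in> GLm n" "X = pcls A"
  using assms by (auto simp: PGLm_def)

lemma mem_PGLm_class:
  assumes "X \<in> PGLm n" "A \<in> X"
  shows "A \<in> GLm n" "X = pcls A"
proof -
  obtain B where B: "B \<in> GLm n" "X = pcls B" using assms(1) by (rule PGLm_E)
  then show "X = pcls A" using assms(2) pcls_eq_iff_mem by blast
  show "A \<in> GLm n" using B assms(2) by (auto simp: pcls_def intro: smult_in_GLm)
qed

text \<open>Classes are equal or disjoint, so \<open>\<Union>U\<close> is the preimage of
  \<open>U\<close> under the projection from \<open>GLm n\<close>, as the quotient topology
  requires.\<close>

lemma mem_Union_classes_iff:
  assumes "U \<subseteq> PGLm n"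
  shows "A \<in> \<Union>U \<longleftrightarrow> pcls A \<in> U"
proof
  show "A \<in> \<Union>U \<Longrightarrow> pcls A \<in> U" using assms mem_PGLm_class by blast
  show "pcls A \<in> U \<Longrightarrow> A \<in> \<Union>U" using pcls_self by blast
qed

lemma pmul_pcls:
  fixes A B :: "'a::field mat"
  assumes "A \<in> carrier_mat n n" "B \<in> carrier_mat n n"
  shows "pmul (pcls A) (pcls B) = pcls (A * B)"
proof
  show "pmul (pcls A) (pcls B) \<subseteq> pcls (A * B)"
    unfolding pmul_def pcls_def using smult_mult_smult_mat[OF assms] by auto
  show "pcls (A * B) \<subseteq> pmul (pcls A) (pcls B)"
  proof
    fix C assume "C \<in> pcls (A * B)"
    then obtain c where "c \<noteq> 0" "C = (c \<cdot>\<^sub>m A) * B"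
      using assms by (auto simp: pcls_def mult_smult_assoc_mat[of _ n n _ n])
    then show "C \<in> pmul (pcls A) (pcls B)"
      unfolding pmul_def using pcls_self[of B] by (auto simp: pcls_def)
  qed
qed

lemma pmul_commute_iff:
  fixes A B :: "'a::field mat"
  assumes "A \<in> carrier_mat n n" "B \<in> carrier_mat n n"
  shows "pmul (pcls A) (pcls B) = pmul (pcls B) (pcls A) \<longleftrightarrow>
    (\<exists>c. c \<noteq> 0 \<and> A * B = c \<cdot>\<^sub>m (B * A))"
  using assms by (simp add: pmul_pcls[of _ n] pcls_eq_iff)

lemma pone_in_PGLm: "pone n \<in> PGLm n"
  by (simp add: pone_def pcls_in_PGLm one_in_GLm)

lemma pmul_in_PGLm: "X \<in> PGLm n \<Longrightarrow> Y \<in> PGLm n \<Longrightarrow> pmul X Y \<in> PGLm n"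
  by (elim PGLm_E) (simp add: pmul_pcls[of _ n] GLm_carrier pcls_in_PGLm mult_in_GLm)

lemma pmul_assoc:
  "X \<in> PGLm n \<Longrightarrow> Y \<in> PGLm n \<Longrightarrow> Z \<in> PGLm n \<Longrightarrow> pmul (pmul X Y) Z = pmul X (pmul Y Z)"
  by (elim PGLm_E)
    (simp add: pmul_pcls[of _ n] GLm_carrier mult_in_GLm assoc_mult_mat[of _ n n _ n _ n])

lemma pmul_pone:
  assumes "X \<in> PGLm n"
  shows "pmul X (pone n) = X" "pmul (pone n) X = X"
  using assms
  by (auto elim!: PGLm_E
      simp: pone_def pmul_pcls[of _ n] left_mult_one_mat[OF GLm_carrier] right_mult_one_mat[OF GLm_carrier]
        GLm_carrier)

lemma pinv_pcls:
  fixes A B :: "'a::field mat"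
  assumes A: "A \<in> carrier_mat n n" and B: "B \<in> carrier_mat n n" and AB: "A * B = 1\<^sub>m n"
  shows "pinv n (pcls A) = pcls B"
proof -
  have BA: "B * A = 1\<^sub>m n"
    using mat_mult_left_right_inverse[OF A B AB] .
  show ?thesis
  proof
    show "pinv n (pcls A) \<subseteq> pcls B"
    proof
      fix C assume "C \<in> pinv n (pcls A)"
      then obtain c where c: "c \<noteq> 0" "C \<in> carrier_mat n n" "(c \<cdot>\<^sub>m A) * C = 1\<^sub>m n"
        by (auto simp: pinv_def pcls_def)
      \<comment> \<open>An element of \<open>pinv\<close> is a right inverse of some representative,
        not necessarily of \<open>A\<close> itself; the factor c accounts for the
        difference.\<close>
      have "B = B * ((c \<cdot>\<^sub>m A) * C)" unfolding c(3) using B by simp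
      also have "\<dots> = c \<cdot>\<^sub>m ((B * A) * C)"
        using A B c(2) by (simp add: mult_smult_distrib[of _ n n _ n] mult_smult_assoc_mat[of _ n n _ n]
            assoc_mult_mat[of _ n n _ n _ n])
      finally have "B = c \<cdot>\<^sub>m C" using BA c by simp
      then show "C \<in> pcls B" using c(1) pcls_eq_iff[of B C] pcls_eq_iff_mem by blast
    qed
    show "pcls B \<subseteq> pinv n (pcls A)"
    proof
      fix C assume "C \<in> pcls B"
      then obtain c where c: "c \<noteq> 0" "C = c \<cdot>\<^sub>m B" by (auto simp: pcls_def)
      have "(inverse c \<cdot>\<^sub>m A) * C = 1\<^sub>m n"
        using c smult_mult_smult_mat[OF A B] AB by (simp add: one_smult_mat)
      moreover have "inverse c \<cdot>\<^sub>m A \<in> pcls A" using c by (auto simp: pcls_def)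
      ultimately show "C \<in> pinv n (pcls A)"
        using c B unfolding pinv_def by auto
    qed
  qed
qed

lemma pinv_in_PGLm:
  assumes "X \<in> PGLm n"
  shows "pinv n X \<in> PGLm n" "pmul X (pinv n X) = pone n" "pmul (pinv n X) X = pone n"
proof -
  obtain A where A: "A \<in> GLm n" "X = pcls A" using assms by (rule PGLm_E)
  obtain B where B: "B \<in> GLm n" "A * B = 1\<^sub>m n" "B * A = 1\<^sub>m n" using A(1) by (rule GLm_inverse)
  have X: "pinv n X = pcls B" unfolding A(2) using GLm_carrier[OF A(1)] GLm_carrier[OF B(1)] B(2) by (rule pinv_pcls)
  show "pinv n X \<in> PGLm n" using X B by (simp add: pcls_in_PGLm)
  show "pmul X (pinv n X) = pone n" "pmul (pinv n X) X = pone n"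
    unfolding X unfolding A(2) using A B by (simp_all add: pmul_pcls[of _ n] GLm_carrier pone_def)
qed

lemma pmul_pinv_commute:
  assumes X: "X \<in> PGLm n" and G: "G \<in> PGLm n" and c: "pmul G X = pmul X G"
  shows "pmul G (pinv n X) = pmul (pinv n X) G"
proof -
  note I = pinv_in_PGLm[OF X]
  have "pmul (pinv n X) G = pmul (pinv n X) (pmul (pmul G X) (pinv n X))"
    using X G I by (simp add: pmul_assoc[of _ n] pmul_pone)
  also have "\<dots> = pmul (pmul (pinv n X) X) (pmul G (pinv n X))"
    unfolding c using X G I(1) by (simp add: pmul_assoc[of _ n] pmul_in_PGLm)
  finally show ?thesis using G I by (simp add: pmul_pone pmul_in_PGLm)
qed

lemma pgen_subset:
  assumes "S \<subseteq> T" "psubgroup n T"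
  shows "pgen n S \<subseteq> T"
proof
  fix X assume "X \<in> pgen n S"
  then show "X \<in> T"
    by induction (use assms in \<open>auto simp: psubgroup_def\<close>)
qed

lemma pgen_mono: "S \<subseteq> T \<Longrightarrow> pgen n S \<subseteq> pgen n T"
proof
  fix X assume "X \<in> pgen n S" and "S \<subseteq> T"
  then show "X \<in> pgen n T"
    by induction (auto intro: pgen.intros)
qed

lemma pmul_commute_pmul:
  assumes "G \<in> PGLm n" "X \<in> PGLm n" "Y \<in> PGLm n" "pmul G X = pmul X G" "pmul G Y = pmul Y G"
  shows "pmul G (pmul X Y) = pmul (pmul X Y) G"
proof -
  have "pmul G (pmul X Y) = pmul (pmul X G) Y"
    using assms(1-3) by (simp add: pmul_assoc[of _ n, symmetric] assms(4))
  also have "\<dots> = pmul (pmul X Y) G"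
    using assms(1-3) by (simp add: pmul_assoc[of _ n] assms(5))
  finally show ?thesis .
qed

lemma psubgroup_pcentralizer:
  assumes "D \<subseteq> PGLm n"
  shows "psubgroup n (pcentralizer n D)"
proof -
  have D: "X \<in> PGLm n" if "X \<in> D" for X
    using that assms by blast
  show ?thesis
    unfolding psubgroup_def
  proof (intro conjI ballI)
    show "pcentralizer n D \<subseteq> PGLm n"
      by (auto simp: pcentralizer_def)
    show "pone n \<in> pcentralizer n D"
      using D by (simp add: pcentralizer_def pone_in_PGLm pmul_pone)
    show "pmul X Y \<in> pcentralizer n D" if "X \<in> pcentralizer n D" "Y \<in> pcentralizer n D" for X Y
      using that D by (simp add: pcentralizer_def pmul_in_PGLm pmul_commute_pmul[of _ n])
    show "pinv n X \<in> pcentralizer n D" if "X \<in> pcentralizer n D" for X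
      using that D by (simp add: pcentralizer_def pinv_in_PGLm pmul_pinv_commute[of _ n])
  qed
qed

text \<open>Commuting is symmetric: if G commutes with \<open>S\<close>, then \<open>S\<close> lies
  in the subgroup \<open>pcentralizer n {G}\<close>, which therefore contains everything that
  \<open>S\<close> generates.\<close>

lemma pcentralizer_pgen:
  assumes "S \<subseteq> PGLm n"
  shows "pcentralizer n (pgen n S) = pcentralizer n S"
proof
  show "pcentralizer n (pgen n S) \<subseteq> pcentralizer n S"
    by (auto simp: pcentralizer_def intro: pgen.gen_base)
  show "pcentralizer n S \<subseteq> pcentralizer n (pgen n S)"
  proof
    fix G assume G: "G \<in> pcentralizer n S"
    then have "S \<subseteq> pcentralizer n {G}"
      using assms by (auto simp: pcentralizer_def)
    moreover have "psubgroup n (pcentralizer n {G})"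
      using G by (intro psubgroup_pcentralizer) (auto simp: pcentralizer_def)
    ultimately have "pgen n S \<subseteq> pcentralizer n {G}" by (rule pgen_subset)
    then show "G \<in> pcentralizer n (pgen n S)"
      using G by (auto simp: pcentralizer_def)
  qed
qed

subsection \<open>The Zariski topology\<close>

lemma istopology_gl_zariski:
  "istopology (\<lambda>U. U \<subseteq> GLm n \<and> (\<exists>F \<subseteq> polyfun n. GLm n - U = {A \<in> GLm n. \<forall>f\<in>F. f A = (0::'a::field)}))"
  (is "istopology ?O")
  unfolding istopology_def
proof (intro conjI allI impI)
  fix S T assume "?O S" "?O T"
  then obtain F G where F: "S \<subseteq> GLm n" "F \<subseteq> polyfun n" "GLm n - S = {A \<in> GLm n. \<forall>f\<in>F. f A = 0}"
    and G: "T \<subseteq> GLm n" "G \<subseteq> polyfun n" "GLm n - T = {A \<in> GLm n. \<forall>f\<in>G. f A = 0}" by auto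
  \<comment> \<open>The union of two zero sets is cut out by the pairwise products, since a field
    has no zero divisors.\<close>
  let ?P = "(\<lambda>(f, g) A. f A * g A) ` (F \<times> G)"
  have "?P \<subseteq> polyfun n" using F G by (auto intro: polyfun.pf_mul)
  moreover have "GLm n - S \<inter> T = {A \<in> GLm n. \<forall>f\<in>?P. f A = 0}"
  proof -
    have "GLm n - S \<inter> T = (GLm n - S) \<union> (GLm n - T)" by blast
    also have "\<dots> = {A \<in> GLm n. (\<forall>f\<in>F. f A = 0) \<or> (\<forall>g\<in>G. g A = 0)}"
      unfolding F G by blast
    also have "\<dots> = {A \<in> GLm n. \<forall>f\<in>F. \<forall>g\<in>G. f A * g A = 0}" by auto
    also have "\<dots> = {A \<in> GLm n. \<forall>f\<in>?P. f A = 0}" by simp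
    finally show ?thesis .
  qed
  ultimately show "\<exists>F \<subseteq> polyfun n. GLm n - S \<inter> T = {A \<in> GLm n. \<forall>f\<in>F. f A = 0}" by blast
  show "S \<inter> T \<subseteq> GLm n" using F by blast
next
  fix K assume K: "\<forall>S\<in>K. ?O S"
  then show "\<Union>K \<subseteq> GLm n" by blast
  from K have "\<forall>S\<in>K. \<exists>F. F \<subseteq> polyfun n \<and> GLm n - S = {A \<in> GLm n. \<forall>f\<in>F. f A = 0}" by blast
  then obtain F where F: "\<forall>S\<in>K. F S \<subseteq> polyfun n \<and> GLm n - S = {A \<in> GLm n. \<forall>f\<in>F S. f A = 0}"
    by (meson bchoice)
  have "GLm n - \<Union>K = {A \<in> GLm n. \<forall>S\<in>K. A \<in> GLm n - S}" by blast
  also have "\<dots> = {A \<in> GLm n. \<forall>f\<in>\<Union>(F ` K). f A = 0}" using F by auto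
  finally show "\<exists>F \<subseteq> polyfun n. GLm n - \<Union>K = {A \<in> GLm n. \<forall>f\<in>F. f A = 0}"
    using F by (intro exI[of _ "\<Union>(F ` K)"]) auto
qed

lemma openin_gl_zariski:
  "openin (gl_zariski n) U \<longleftrightarrow> U \<subseteq> GLm n \<and>
     (\<exists>F \<subseteq> polyfun n. GLm n - U = {A \<in> GLm n. \<forall>f\<in>F. f A = (0::'a::field)})"
  unfolding gl_zariski_def topology_inverse'[OF istopology_gl_zariski] ..

lemma openin_gl_zariski_nonvanishing:
  assumes "F \<subseteq> polyfun n"
  shows "openin (gl_zariski n) {A \<in> GLm n. \<exists>f\<in>F. f A \<noteq> (0::'a::field)}"
  unfolding openin_gl_zariski using assms by (intro conjI exI[of _ F]) auto

lemma istopology_pgl_zariski: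
  "istopology (\<lambda>U. U \<subseteq> PGLm n \<and> openin (gl_zariski n) (\<Union>U :: 'a::field mat set))"
  unfolding istopology_def
proof (intro conjI allI impI)
  fix S T :: "'a mat set set"
  assume S: "S \<subseteq> PGLm n \<and> openin (gl_zariski n) (\<Union>S)"
    and T: "T \<subseteq> PGLm n \<and> openin (gl_zariski n) (\<Union>T)"
  \<comment> \<open>For arbitrary families of sets only one inclusion holds; equality rests on
    distinct classes being disjoint.\<close>
  have "\<Union>(S \<inter> T) = \<Union>S \<inter> \<Union>T"
    using mem_Union_classes_iff[of S n] mem_Union_classes_iff[of T n]
      mem_Union_classes_iff[of "S \<inter> T" n] S T by blast
  then show "openin (gl_zariski n) (\<Union>(S \<inter> T))" using S T by auto
  show "S \<inter> T \<subseteq> PGLm n" using S by blast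
next
  fix K :: "'a mat set set set"
  assume K: "\<forall>S\<in>K. S \<subseteq> PGLm n \<and> openin (gl_zariski n) (\<Union>S)"
  then show "\<Union>K \<subseteq> PGLm n" by blast
  have "\<Union>(\<Union>K) = \<Union>(Union ` K)" by blast
  then show "openin (gl_zariski n) (\<Union>(\<Union>K))" using K by auto
qed

lemma openin_pgl_zariski:
  "openin (pgl_zariski n) U \<longleftrightarrow> U \<subseteq> PGLm n \<and> openin (gl_zariski n) (\<Union>U)"
  unfolding pgl_zariski_def topology_inverse'[OF istopology_pgl_zariski] ..

lemma Union_PGLm: "\<Union>(PGLm n) = GLm n"
proof
  show "\<Union>(PGLm n) \<subseteq> (GLm n :: 'a mat set)" using mem_PGLm_class(1) by blast
  show "GLm n \<subseteq> \<Union>(PGLm n :: 'a mat set set)" using pcls_in_PGLm pcls_self by blast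
qed

lemma topspace_pgl_zariski: "topspace (pgl_zariski n) = (PGLm n :: 'a::field mat set set)"
proof
  have "openin (gl_zariski n) (GLm n :: 'a mat set)"
    using openin_gl_zariski_nonvanishing[of "{\<lambda>A. 1 :: 'a}" n] by (simp add: polyfun.pf_const)
  then have "openin (pgl_zariski n) (PGLm n :: 'a mat set set)"
    by (simp add: openin_pgl_zariski Union_PGLm)
  then show "PGLm n \<subseteq> topspace (pgl_zariski n :: 'a mat set topology)" by (rule openin_subset)
  show "topspace (pgl_zariski n) \<subseteq> (PGLm n :: 'a mat set set)"
    using openin_topspace[of "pgl_zariski n :: 'a mat set topology"] unfolding openin_pgl_zariski by blast
qed

text \<open>Polynomials in the entries are not functions on classes. Invariance of \<open>P\<close>
  under scaling makes its solution set a union of whole classes, so that it descends to the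
  quotient.\<close>

lemma openin_pgl_zariski_nonvanishing:
  fixes P :: "'a::field mat \<Rightarrow> bool"
  assumes F: "F \<subseteq> polyfun n"
    and P: "\<And>A. A \<in> GLm n \<Longrightarrow> P A \<longleftrightarrow> (\<exists>f\<in>F. f A \<noteq> 0)"
    and inv: "\<And>A c. A \<in> GLm n \<Longrightarrow> c \<noteq> 0 \<Longrightarrow> P A \<Longrightarrow> P (c \<cdot>\<^sub>m A)"
  shows "openin (pgl_zariski n) (pcls ` {A \<in> GLm n. P A})"
proof -
  have "\<Union>(pcls ` {A \<in> GLm n. P A}) = {A \<in> GLm n. P A}"
  proof
    show "\<Union>(pcls ` {A \<in> GLm n. P A}) \<subseteq> {A \<in> GLm n. P A}"
      using inv smult_in_GLm by (auto simp: pcls_def)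
    show "{A \<in> GLm n. P A} \<subseteq> \<Union>(pcls ` {A \<in> GLm n. P A})"
      using pcls_self by blast
  qed
  also have "\<dots> = {A \<in> GLm n. \<exists>f\<in>F. f A \<noteq> 0}"
    using P by (intro Collect_cong conj_cong refl)
  finally show ?thesis
    using openin_gl_zariski_nonvanishing[OF F] by (auto simp: openin_pgl_zariski intro: pcls_in_PGLm)
qed

section \<open>Polynomials on lines of matrices, and connectedness of lines\<close>

lemma infinite_UNIV_alg_closed_field: "infinite (UNIV :: 'a::alg_closed_field set)"
proof
  assume fin: "finite (UNIV :: 'a set)"
  \<comment> \<open>Over a finite field this polynomial vanishes everywhere, so \<open>P + 1\<close>
    would have positive degree and no root.\<close>
  define P where "P = (\<Prod>a\<in>(UNIV :: 'a set). [:-a, 1:])"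
  have "degree P = card (UNIV :: 'a set)"
    unfolding P_def by (subst degree_prod_eq_sum_degree) auto
  moreover have "card (UNIV :: 'a set) > 0" using fin by (simp add: card_gt_0_iff)
  ultimately have "degree (P + 1) > 0"
    by (simp add: degree_add_eq_left)
  then obtain x where "poly (P + 1) x = 0" using alg_closed_imp_poly_has_root by blast
  moreover have "poly P x = 0"
    unfolding P_def poly_prod using fin by (intro prod_zero) auto
  ultimately show False by simp
qed

lemma polyfun_on_line:
  fixes A B :: "'a::field mat"
  assumes "f \<in> polyfun n" "A \<in> carrier_mat n n" "B \<in> carrier_mat n n"
  shows "\<exists>P. \<forall>t. f (A + t \<cdot>\<^sub>m B) = poly P t"
  using assms(1)
proof induction
  case (pf_const c)
  show ?case by (intro exI[of _ "[:c:]"]) simp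
next
  case (pf_entry i j)
  then show ?case using assms(2,3) by (intro exI[of _ "[:A $$ (i, j), B $$ (i, j):]"]) simp
next
  case (pf_add f g)
  then show ?case by (metis poly_add)
next
  case (pf_mul f g)
  then show ?case by (metis poly_mult)
qed

text \<open>The polynomials describing an open set say something only about invertible matrices, so
  invertibility along the line needs a polynomial of its own, read off from the Leibniz
  formula.\<close>

lemma det_on_line:
  fixes A B :: "'a::field mat"
  assumes "A \<in> carrier_mat n n" "B \<in> carrier_mat n n"
  shows "\<exists>P. \<forall>t. det (A + t \<cdot>\<^sub>m B) = poly P t"
proof (intro exI allI)
  fix t
  let ?L = "\<lambda>i j. [:A $$ (i, j), B $$ (i, j):]"
  have "det (A + t \<cdot>\<^sub>m B) = (\<Sum>p | p permutes {0..<n}. signof p * (\<Prod>i = 0..<n. (A + t \<cdot>\<^sub>m B) $$ (i, p i)))"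
    using assms by (intro det_def') auto
  also have "\<dots> = (\<Sum>p | p permutes {0..<n}. signof p * (\<Prod>i = 0..<n. poly (?L i (p i)) t))"
  proof (intro sum.cong refl arg_cong2[where f = "(*)"] prod.cong)
    fix p i assume "p \<in> {p. p permutes {0..<n}}" "i \<in> {0..<n}"
    then have "i < n" "p i < n" using permutes_in_image[of p "{0..<n}" i] by auto
    then show "(A + t \<cdot>\<^sub>m B) $$ (i, p i) = poly (?L i (p i)) t" using assms by simp
  qed
  finally show "det (A + t \<cdot>\<^sub>m B) =
      poly (\<Sum>p | p permutes {0..<n}. [:signof p:] * (\<Prod>i = 0..<n. ?L i (p i))) t"
    by (simp add: poly_sum poly_prod)
qed

text \<open>Nonempty open subsets of a line are cofinite, and the field is infinite.\<close>

lemma connectedin_line: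
  fixes A B :: "'a::alg_closed_field mat"
  assumes "A \<in> carrier_mat n n" "B \<in> carrier_mat n n"
  shows "connectedin (pgl_zariski n) {pcls (A + t \<cdot>\<^sub>m B) | t. A + t \<cdot>\<^sub>m B \<in> GLm n}"
    (is "connectedin _ ?T")
proof -
  \<comment> \<open>The witness is a product: one factor is the restriction to the line of a
    polynomial not vanishing at a point of \<open>U\<close>, the other is the determinant.\<close>
  have *: "\<exists>P. P \<noteq> 0 \<and> (\<forall>t. poly P t \<noteq> 0 \<longrightarrow> A + t \<cdot>\<^sub>m B \<in> GLm n \<and> pcls (A + t \<cdot>\<^sub>m B) \<in> U)"
    if U: "openin (pgl_zariski n) U" "U \<inter> ?T \<noteq> {}" for U
  proof -
    have sub: "U \<subseteq> PGLm n" using U(1) by (simp add: openin_pgl_zariski)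
    obtain F where F: "F \<subseteq> polyfun n" "GLm n - \<Union>U = {A \<in> GLm n. \<forall>f\<in>F. f A = 0}"
      using U(1) by (auto simp: openin_pgl_zariski openin_gl_zariski)
    obtain t where t: "A + t \<cdot>\<^sub>m B \<in> GLm n" "A + t \<cdot>\<^sub>m B \<in> \<Union>U"
      using U(2) mem_Union_classes_iff[OF sub] by auto
    with F(2) obtain f where f: "f \<in> F" "f (A + t \<cdot>\<^sub>m B) \<noteq> 0" by blast
    obtain P where P: "\<forall>t. f (A + t \<cdot>\<^sub>m B) = poly P t"
      using polyfun_on_line[of f n A B] f F assms by blast
    obtain Q where Q: "\<forall>t. det (A + t \<cdot>\<^sub>m B) = poly Q t"
      using det_on_line[OF assms] by blast
    have "poly (P * Q) t \<noteq> 0" using P Q t f by (auto simp: GLm_def)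
    then have "P * Q \<noteq> 0" by (metis poly_0)
    moreover have "A + t \<cdot>\<^sub>m B \<in> GLm n \<and> pcls (A + t \<cdot>\<^sub>m B) \<in> U" if "poly (P * Q) t \<noteq> 0" for t
    proof
      show gl: "A + t \<cdot>\<^sub>m B \<in> GLm n" using that Q assms by (auto simp: GLm_def)
      have "f (A + t \<cdot>\<^sub>m B) \<noteq> 0" using that P by simp
      then have "A + t \<cdot>\<^sub>m B \<in> \<Union>U" using F(2) f(1) gl by blast
      then show "pcls (A + t \<cdot>\<^sub>m B) \<in> U" using mem_Union_classes_iff[OF sub] by blast
    qed
    ultimately show ?thesis by blast
  qed
  \<comment> \<open>This is irreducibility, which is stronger than connectedness: any two open sets
    that meet the line meet each other on it.\<close>
  have "E1 \<inter> E2 \<inter> ?T \<noteq> {}"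
    if E: "openin (pgl_zariski n) E1" "openin (pgl_zariski n) E2" "E1 \<inter> ?T \<noteq> {}" "E2 \<inter> ?T \<noteq> {}"
    for E1 E2
  proof -
    obtain P Q where P: "P \<noteq> 0" "\<forall>t. poly P t \<noteq> 0 \<longrightarrow> A + t \<cdot>\<^sub>m B \<in> GLm n \<and> pcls (A + t \<cdot>\<^sub>m B) \<in> E1"
      and Q: "Q \<noteq> 0" "\<forall>t. poly Q t \<noteq> 0 \<longrightarrow> A + t \<cdot>\<^sub>m B \<in> GLm n \<and> pcls (A + t \<cdot>\<^sub>m B) \<in> E2"
      using *[OF E(1,3)] *[OF E(2,4)] by blast
    have "finite {t. poly (P * Q) t = 0}" using P Q by (intro poly_roots_finite) simp
    then obtain t where "poly (P * Q) t \<noteq> 0"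
      using infinite_UNIV_alg_closed_field ex_new_if_finite by blast
    then show ?thesis using P Q by auto
  qed
  then show ?thesis
    unfolding connectedin topspace_pgl_zariski by (auto intro: pcls_in_PGLm)
qed

subsection \<open>Commutation up to scalars\<close>

lemma GLm_nonzero_entry:
  fixes A :: "'a::field mat"
  assumes "A \<in> GLm n" "n > 0"
  obtains i j where "i < n" "j < n" "A $$ (i, j) \<noteq> 0"
proof (rule ccontr)
  assume "\<not> thesis"
  then have "A = 0\<^sub>m n n" using that assms(1) by (intro eq_matI) (auto simp: GLm_def)
  then show False using assms by (simp add: GLm_def det_zero)
qed

text \<open>Commutation scalars are unique, by comparison at a nonzero entry. A matrix of size 0
  absorbs every scalar, hence \<open>n > 0\<close>.\<close>

lemma GLm_smult_cancel:
  fixes A :: "'a::field mat"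
  assumes "A \<in> GLm n" "n > 0" "c \<cdot>\<^sub>m A = d \<cdot>\<^sub>m A"
  shows "c = d"
proof -
  obtain i j where ij: "i < n" "j < n" "A $$ (i, j) \<noteq> 0" using assms(1,2) by (rule GLm_nonzero_entry)
  have "(c \<cdot>\<^sub>m A) $$ (i, j) = (d \<cdot>\<^sub>m A) $$ (i, j)" using assms(3) by simp
  then show ?thesis using ij GLm_carrier[OF assms(1)] by simp
qed

text \<open>The commutation scalar with a fixed \<open>Z\<close> behaves like a character; this is
  what allows one factor to cancel the scalar of another.\<close>

lemma scalar_commute_mult:
  fixes X Y Z :: "'a::field mat"
  assumes carr: "X \<in> carrier_mat n n" "Y \<in> carrier_mat n n" "Z \<in> carrier_mat n n"
    and X: "X * Z = c \<cdot>\<^sub>m (Z * X)" and Y: "Y * Z = d \<cdot>\<^sub>m (Z * Y)"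
  shows "(X * Y) * Z = (c * d) \<cdot>\<^sub>m (Z * (X * Y))"
proof -
  have "(X * Y) * Z = d \<cdot>\<^sub>m ((X * Z) * Y)"
    using carr by (simp add: assoc_mult_mat[of _ n n _ n _ n] Y mult_smult_distrib[of _ n n _ n])
  also have "\<dots> = (c * d) \<cdot>\<^sub>m (Z * (X * Y))"
    unfolding X using carr
    by (simp add: mult_smult_assoc_mat[of _ n n _ n] smult_smult_mat assoc_mult_mat[of _ n n _ n _ n]
        mult.commute)
  finally show ?thesis .
qed

lemma scalar_commute_power:
  fixes X Z :: "'a::field mat"
  assumes carr: "X \<in> carrier_mat n n" "Z \<in> carrier_mat n n"
    and X: "X * Z = c \<cdot>\<^sub>m (Z * X)"
  shows "(X ^\<^sub>m m) * Z = (c ^ m) \<cdot>\<^sub>m (Z * (X ^\<^sub>m m))"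
proof (induction m)
  case 0
  show ?case using carr by (simp add: one_smult_mat)
next
  case (Suc m)
  show ?case
    using scalar_commute_mult[OF _ carr Suc X] pow_carrier_mat[OF carr(1)]
    by (simp add: mult.commute)
qed

lemma pow_in_GLm: "A \<in> GLm n \<Longrightarrow> A ^\<^sub>m m \<in> GLm n"
proof (induction m)
  case 0
  then have "A ^\<^sub>m 0 = 1\<^sub>m n" using GLm_carrier by auto
  then show ?case by (simp only: one_in_GLm)
qed (simp add: mult_in_GLm)

lemma pcls_pow_in_pgen:
  assumes "A \<in> GLm n" "pcls A \<in> pgen n S"
  shows "pcls (A ^\<^sub>m m) \<in> pgen n S"
proof (induction m)
  case 0
  have "A ^\<^sub>m 0 = 1\<^sub>m n" using GLm_carrier[OF assms(1)] by auto
  then have "pcls (A ^\<^sub>m 0) = pone n" by (simp only: pone_def)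
  then show ?case by (simp only: pgen.gen_one)
next
  case (Suc m)
  have "pcls (A ^\<^sub>m Suc m) = pmul (pcls (A ^\<^sub>m m)) (pcls A)"
    using assms(1) pmul_pcls[of "A ^\<^sub>m m" n A] by (simp add: GLm_carrier pow_in_GLm)
  then show ?case using Suc assms(2) by (simp only: pgen.gen_mul)
qed

lemma polyfun_sum: "(\<And>x. x \<in> S \<Longrightarrow> f x \<in> polyfun n) \<Longrightarrow> (\<lambda>A. \<Sum>x\<in>S. f x A) \<in> polyfun n"
  by (induction S rule: infinite_finite_induct) (auto intro: polyfun.intros)

text \<open>The excluded equation is linear and homogeneous in A, so it defines a closed set of
  classes.\<close>

lemma openin_not_scalar_commute:
  fixes h :: "'a::field mat"
  assumes h: "h \<in> carrier_mat n n"
  shows "openin (pgl_zariski n) (pcls ` {A \<in> GLm n. A * h \<noteq> c \<cdot>\<^sub>m (h * A)})"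
proof -
  \<comment> \<open>The entries of \<open>A * h - c * (h * A)\<close>, with the subtraction written
    through \<open>- c\<close> because \<open>polyfun\<close> is generated by sums and products
    only.\<close>
  define f where
    "f = (\<lambda>(i, j) A. (\<Sum>l<n. A $$ (i, l) * h $$ (l, j)) + (- c) * (\<Sum>l<n. h $$ (i, l) * A $$ (l, j)))"
  show ?thesis
  proof (rule openin_pgl_zariski_nonvanishing)
    show "f ` ({..<n} \<times> {..<n}) \<subseteq> polyfun n"
    proof (rule image_subsetI)
      fix x assume "x \<in> {..<n} \<times> {..<n}"
      then obtain i j where x: "x = (i, j)" "i < n" "j < n" by auto
      then show "f x \<in> polyfun n"
        unfolding f_def x(1) prod.case by (intro polyfun.intros polyfun_sum) auto
    qed
    fix A :: "'a mat" assume A: "A \<in> GLm n"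
    have f: "f (i, j) A = (A * h) $$ (i, j) - (c \<cdot>\<^sub>m (h * A)) $$ (i, j)" if "i < n" "j < n" for i j
      using that h GLm_carrier[OF A] by (simp add: f_def scalar_prod_def lessThan_atLeast0)
    have "A * h = c \<cdot>\<^sub>m (h * A) \<longleftrightarrow> (\<forall>i<n. \<forall>j<n. (A * h) $$ (i, j) = (c \<cdot>\<^sub>m (h * A)) $$ (i, j))"
      (is "?L \<longleftrightarrow> ?R")
    proof
      assume e: ?L
      show ?R unfolding e by blast
    next
      assume ?R
      then show ?L by (intro eq_matI) (use h GLm_carrier[OF A] in auto)
    qed
    also have "\<dots> \<longleftrightarrow> (\<forall>i<n. \<forall>j<n. f (i, j) A = 0)"
      using f by simp
    finally show "A * h \<noteq> c \<cdot>\<^sub>m (h * A) \<longleftrightarrow> (\<exists>g\<in>f ` ({..<n} \<times> {..<n}). g A \<noteq> 0)"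
      by auto
  next
    fix A :: "'a mat" and d :: 'a
    assume A: "A \<in> GLm n" and d: "d \<noteq> 0" and ne: "A * h \<noteq> c \<cdot>\<^sub>m (h * A)"
    show "(d \<cdot>\<^sub>m A) * h \<noteq> c \<cdot>\<^sub>m (h * (d \<cdot>\<^sub>m A))"
    proof
      assume "(d \<cdot>\<^sub>m A) * h = c \<cdot>\<^sub>m (h * (d \<cdot>\<^sub>m A))"
      then have "d \<cdot>\<^sub>m (A * h) = d \<cdot>\<^sub>m (c \<cdot>\<^sub>m (h * A))"
        using h GLm_carrier[OF A]
        by (simp add: mult_smult_assoc_mat[of _ n n _ n] mult_smult_distrib[of _ n n _ n]
            smult_smult_mat mult.commute)
      then have "inverse d \<cdot>\<^sub>m (d \<cdot>\<^sub>m (A * h)) = inverse d \<cdot>\<^sub>m (d \<cdot>\<^sub>m (c \<cdot>\<^sub>m (h * A)))" by simp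
      then show False using ne d by (simp add: smult_smult_mat one_smult_mat mult.assoc[symmetric])
    qed
  qed
qed

text \<open>The scalar by which an element of the centralizer commutes with h is, by determinants, a
  root of unity, and hence constant on a connected centralizer.\<close>

lemma connected_centralizer_commutes:
  fixes h g :: "'a::field mat"
  assumes conn: "connectedin (pgl_zariski n) (pcentralizer n H)" and n: "n > 0"
    and HP: "H \<subseteq> PGLm n" and h: "h \<in> GLm n" "pcls h \<in> H"
    and g: "g \<in> GLm n" "pcls g \<in> pcentralizer n H"
  shows "g * h = h * g"
proof (rule ccontr)
  assume gh: "g * h \<noteq> h * g"
  note hc = GLm_carrier[OF h(1)]
  define R where "R = {c::'a. c ^ n = 1}"
  define V where "V c = pcls ` {A \<in> GLm n. A * h \<noteq> c \<cdot>\<^sub>m (h * A)}" for c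
  have V: "openin (pgl_zariski n) (V c)" for c
    unfolding V_def by (rule openin_not_scalar_commute[OF hc])
  \<comment> \<open>On the centralizer every scalar lies in \<open>R\<close>, so there
    \<open>W\<close> means scalar 1 and \<open>V 1\<close> means any other scalar. Finiteness of
    \<open>R\<close> makes \<open>W\<close> open. The factor \<open>PGLm n\<close> matters when
    \<open>R = {1}\<close>, where the intersection over the empty index set is everything.\<close>
  define W where "W = (\<Inter>c\<in>R - {1}. V c) \<inter> PGLm n"
  have "coeff (monom (1::'a) n - 1) n \<noteq> 0" using n by simp
  then have "monom (1::'a) n - 1 \<noteq> 0" by (metis coeff_0)
  then have "finite {c::'a. poly (monom 1 n - 1) c = 0}" by (rule poly_roots_finite)
  then have "finite R" by (simp add: R_def poly_monom)
  then have W: "openin (pgl_zariski n) W"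
    unfolding W_def topspace_pgl_zariski[symmetric] using V by (intro openin_INT) auto
  have comm: "\<exists>c\<in>R. A * h = c \<cdot>\<^sub>m (h * A)" if A: "A \<in> GLm n" "pcls A \<in> pcentralizer n H" for A
  proof -
    obtain c where c: "c \<noteq> 0" "A * h = c \<cdot>\<^sub>m (h * A)"
      using A h(2) pmul_commute_iff[OF GLm_carrier[OF A(1)] hc] by (auto simp: pcentralizer_def)
    have "det (A * h) = c ^ n * det (h * A)"
      unfolding c(2) using GLm_carrier[OF A(1)] by simp
    then have "c ^ n = 1"
      using GLm_carrier[OF A(1)] hc A(1) h(1) by (simp add: det_mult GLm_def)
    then show ?thesis using c by (auto simp: R_def)
  qed
  have "pone n \<in> pcentralizer n H"
    using psubgroup_pcentralizer[OF HP] by (simp add: psubgroup_def)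
  moreover have one_W: "pone n \<in> W"
  proof -
    have "1\<^sub>m n * h \<noteq> c \<cdot>\<^sub>m (h * 1\<^sub>m n)" if "c \<noteq> 1" for c
      using that hc GLm_smult_cancel[OF h(1) n, of 1 c] by (auto simp: one_smult_mat)
    then show ?thesis by (auto simp: W_def V_def pone_def one_in_GLm pcls_in_PGLm)
  qed
  moreover have "pcls g \<in> V 1"
    unfolding V_def using gh g(1) by (auto simp: one_smult_mat)
  moreover have "pcentralizer n H \<subseteq> V 1 \<union> W"
  proof
    fix X assume X: "X \<in> pcentralizer n H"
    then obtain A where A: "A \<in> GLm n" "X = pcls A" by (auto simp: pcentralizer_def PGLm_def)
    show "X \<in> V 1 \<union> W"
    proof (cases "A * h = h * A")
      case True
      have "A * h \<noteq> c \<cdot>\<^sub>m (h * A)" if "c \<noteq> 1" for c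
        using that True GLm_smult_cancel[OF mult_in_GLm[OF h(1) A(1)] n, of 1 c]
        by (auto simp: one_smult_mat)
      then have "X \<in> W" using A by (auto simp: W_def V_def pcls_in_PGLm)
      then show ?thesis ..
    next
      case False
      then show ?thesis using A by (auto simp: V_def one_smult_mat)
    qed
  qed
  moreover have "V 1 \<inter> W \<inter> pcentralizer n H = {}"
  proof (rule ccontr)
    assume "V 1 \<inter> W \<inter> pcentralizer n H \<noteq> {}"
    then obtain X where X: "X \<in> V 1" "X \<in> W" "X \<in> pcentralizer n H" by blast
    then obtain A where A: "A \<in> GLm n" "X = pcls A" "A * h \<noteq> 1 \<cdot>\<^sub>m (h * A)" by (auto simp: V_def)
    then obtain c where c: "c \<in> R" "A * h = c \<cdot>\<^sub>m (h * A)" using comm X(3) by blast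
    with A have "c \<noteq> 1" by auto
    with c X(2) have "X \<in> V c" by (auto simp: W_def)
    \<comment> \<open>Membership in \<open>V c\<close> concerns some representative of the class; as
      a multiple of \<open>A\<close>, it commutes with \<open>h\<close> up to the same
      scalar.\<close>
    then obtain B where B: "B \<in> GLm n" "pcls A = pcls B" "B * h \<noteq> c \<cdot>\<^sub>m (h * B)"
      using A(2) by (auto simp: V_def)
    then obtain d where "B = d \<cdot>\<^sub>m A" using pcls_eq_iff[of B A] by metis
    then have "B * h = c \<cdot>\<^sub>m (h * B)"
      using c(2) hc GLm_carrier[OF A(1)]
      by (simp add: mult_smult_assoc_mat[of _ n n _ n] mult_smult_distrib[of _ n n _ n]
            smult_smult_mat mult.commute)
    then show False using B by simp
  qed
  ultimately show False
    using conn V[of 1] W g(2) unfolding connectedin by blast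
qed

subsection \<open>Kronecker products\<close>

lemma block_index_less:
  assumes "a < k" "b < (q::nat)"
  shows "a * q + b < k * q"
proof -
  have "a * q + b < Suc a * q" using assms(2) by simp
  also have "\<dots> \<le> k * q" using assms(1) by (intro mult_right_mono) auto
  finally show ?thesis .
qed

lemma div_mod_block:
  assumes "i < k * (q::nat)"
  shows "i div q < k" "i mod q < q"
  using assms by (auto simp: less_mult_imp_div_less intro!: mod_less_divisor gr0I)

text \<open>The index \<open>a * q + b\<close> encodes position \<open>a\<close> in the left and
  \<open>b\<close> in the right tensor factor, which is the ordering used by
  \<open>kron\<close>.\<close>

lemma sum_blocks:
  fixes F :: "nat \<Rightarrow> 'b::comm_monoid_add"
  shows "(\<Sum>l<k * q. F l) = (\<Sum>a<k. \<Sum>b<q. F (a * q + b))"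
  unfolding sum.cartesian_product
  by (rule sum.reindex_bij_witness[of _ "\<lambda>(a, b). a * q + b" "\<lambda>l. (l div q, l mod q)"])
    (auto simp: div_mod_block block_index_less)

lemma kron_carrier:
  "A \<in> carrier_mat k k \<Longrightarrow> B \<in> carrier_mat q q \<Longrightarrow> kron A B \<in> carrier_mat (k * q) (k * q)"
  by (auto simp: kron_def)

lemma kron_index:
  "A \<in> carrier_mat k k \<Longrightarrow> B \<in> carrier_mat q q \<Longrightarrow> i < k * q \<Longrightarrow> j < k * q \<Longrightarrow>
    kron A B $$ (i, j) = A $$ (i div q, j div q) * B $$ (i mod q, j mod q)"
  by (auto simp: kron_def)

lemma kron_mult:
  fixes A B C D :: "'a::field mat"
  assumes A: "A \<in> carrier_mat k k" and B: "B \<in> carrier_mat q q"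
    and C: "C \<in> carrier_mat k k" and D: "D \<in> carrier_mat q q"
  shows "kron A B * kron C D = kron (A * C) (B * D)"
proof (rule eq_matI)
  note carr = kron_carrier[OF A B] kron_carrier[OF C D] kron_carrier[of "A * C" k "B * D" q]
  fix i j assume "i < dim_row (kron (A * C) (B * D))" "j < dim_col (kron (A * C) (B * D))"
  then have ij: "i < k * q" "j < k * q" using carr A B C D by auto
  note b = div_mod_block[OF ij(1)] div_mod_block[OF ij(2)]
  have "(kron A B * kron C D) $$ (i, j) = (\<Sum>l<k * q. kron A B $$ (i, l) * kron C D $$ (l, j))"
    using carr ij by (simp add: scalar_prod_def lessThan_atLeast0)
  also have "\<dots> = (\<Sum>a<k. \<Sum>b<q. (A $$ (i div q, a) * C $$ (a, j div q)) * (B $$ (i mod q, b) * D $$ (b, j mod q)))"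
    unfolding sum_blocks
  proof (intro sum.cong refl)
    fix a b assume "a \<in> {..<k}" "b \<in> {..<q}"
    then have ab: "a < k" "b < q" by auto
    then have "a * q + b < k * q" by (intro block_index_less)
    then show "kron A B $$ (i, a * q + b) * kron C D $$ (a * q + b, j) =
        (A $$ (i div q, a) * C $$ (a, j div q)) * (B $$ (i mod q, b) * D $$ (b, j mod q))"
      using ab ij by (simp add: kron_index[OF A B] kron_index[OF C D])
  qed
  also have "\<dots> = (\<Sum>a<k. A $$ (i div q, a) * C $$ (a, j div q)) * (\<Sum>b<q. B $$ (i mod q, b) * D $$ (b, j mod q))"
    by (simp add: sum_product)
  also have "\<dots> = (A * C) $$ (i div q, j div q) * (B * D) $$ (i mod q, j mod q)"
    using A B C D b by (simp add: scalar_prod_def lessThan_atLeast0)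
  also have "\<dots> = kron (A * C) (B * D) $$ (i, j)"
    using A B C D ij by (subst kron_index[of _ k _ q]) auto
  finally show "(kron A B * kron C D) $$ (i, j) = kron (A * C) (B * D) $$ (i, j)" .
qed (use A B C D in \<open>auto simp: kron_def\<close>)

lemma kron_one: "kron (1\<^sub>m k) (1\<^sub>m q) = (1\<^sub>m (k * q) :: 'a::field mat)"
proof (rule eq_matI)
  fix i j assume "i < dim_row (1\<^sub>m (k * q))" "j < dim_col (1\<^sub>m (k * q))"
  then have ij: "i < k * q" "j < k * q" by auto
  have "i = j \<longleftrightarrow> i div q = j div q \<and> i mod q = j mod q" by (metis div_mult_mod_eq)
  then show "kron (1\<^sub>m k) (1\<^sub>m q) $$ (i, j) = (1\<^sub>m (k * q) :: 'a mat) $$ (i, j)"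
    using ij div_mod_block[OF ij(1)] div_mod_block[OF ij(2)]
    by (auto simp: kron_index[of _ k _ q])
qed (auto simp: kron_def)

lemma kron_smult_right:
  fixes A B :: "'a::field mat"
  assumes A: "A \<in> carrier_mat k k" and B: "B \<in> carrier_mat q q"
  shows "kron A (c \<cdot>\<^sub>m B) = c \<cdot>\<^sub>m kron A B"
proof (rule eq_matI)
  fix i j assume "i < dim_row (c \<cdot>\<^sub>m kron A B)" "j < dim_col (c \<cdot>\<^sub>m kron A B)"
  then have ij: "i < k * q" "j < k * q" using kron_carrier[OF A B] by auto
  then show "kron A (c \<cdot>\<^sub>m B) $$ (i, j) = (c \<cdot>\<^sub>m kron A B) $$ (i, j)"
    using A B kron_carrier[OF A B] div_mod_block[OF ij(1)] div_mod_block[OF ij(2)]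
    by (simp add: kron_index[of _ k _ q])
qed (auto simp: kron_def)

text \<open>Inverting factor by factor avoids the determinant of a Kronecker product.\<close>

lemma kron_in_GLm:
  fixes A B :: "'a::field mat"
  assumes "A \<in> GLm k" "B \<in> GLm q"
  shows "kron A B \<in> GLm (k * q)"
proof -
  obtain A' where A': "A' \<in> GLm k" "A * A' = 1\<^sub>m k" using assms(1) by (rule GLm_inverse)
  obtain B' where B': "B' \<in> GLm q" "B * B' = 1\<^sub>m q" using assms(2) by (rule GLm_inverse)
  have "kron A B * kron A' B' = 1\<^sub>m (k * q)"
    using assms A' B' by (simp add: kron_mult[of _ k _ q] GLm_carrier kron_one)
  then show ?thesis
    using right_inverse_in_GLm(1) kron_carrier assms A'(1) B'(1) GLm_carrier by metis
qed

text \<open>If \<open>g\<close> vanishes at all index pairs with different residues modulo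
  \<open>q\<close>, then sorting the indices by residue makes it block diagonal; this is the block
  of residue 0.\<close>

definition corner :: "nat \<Rightarrow> nat \<Rightarrow> 'a mat \<Rightarrow> 'a mat" where
  "corner k q g = mat k k (\<lambda>(a, a'). g $$ (a * q, a' * q))"

text \<open>Row \<open>a * q\<close> of \<open>g\<close> is supported on columns of residue 0, so
  the other summands of the product disappear. No shape is required of \<open>x\<close>, which may
  thus be an inverse of \<open>g\<close>.\<close>

lemma corner_mult:
  fixes g x :: "'a::field mat"
  assumes g: "g \<in> carrier_mat (k * q) (k * q)" and x: "x \<in> carrier_mat (k * q) (k * q)" and q: "q > 0"
    and blocks: "\<And>i j. i < k * q \<Longrightarrow> j < k * q \<Longrightarrow> i mod q \<noteq> j mod q \<Longrightarrow> g $$ (i, j) = 0"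
  shows "corner k q (g * x) = corner k q g * corner k q x"
proof (rule eq_matI)
  fix a a' assume "a < dim_row (corner k q g * corner k q x)" "a' < dim_col (corner k q g * corner k q x)"
  then have a: "a < k" "a' < k" by (auto simp: corner_def)
  then have aq: "a * q < k * q" "a' * q < k * q" using q by auto
  have "corner k q (g * x) $$ (a, a') = (\<Sum>l<k * q. g $$ (a * q, l) * x $$ (l, a' * q))"
    using a aq g x by (simp add: corner_def scalar_prod_def lessThan_atLeast0)
  also have "\<dots> = (\<Sum>c<k. g $$ (a * q, c * q) * x $$ (c * q, a' * q))"
    unfolding sum_blocks
  proof (intro sum.cong refl)
    fix c assume "c \<in> {..<k}"
    then have c: "c < k" by simp
    have "(\<Sum>b<q. g $$ (a * q, c * q + b) * x $$ (c * q + b, a' * q)) =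
        (\<Sum>b<q. if b = 0 then g $$ (a * q, c * q + b) * x $$ (c * q + b, a' * q) else 0)"
    proof (intro sum.cong refl)
      fix b assume "b \<in> {..<q}"
      then have b: "b < q" by simp
      then have "c * q + b < k * q" using c by (intro block_index_less)
      then show "g $$ (a * q, c * q + b) * x $$ (c * q + b, a' * q) =
          (if b = 0 then g $$ (a * q, c * q + b) * x $$ (c * q + b, a' * q) else 0)"
        using blocks[of "a * q" "c * q + b"] aq b by auto
    qed
    then show "(\<Sum>b<q. g $$ (a * q, c * q + b) * x $$ (c * q + b, a' * q)) =
        g $$ (a * q, c * q) * x $$ (c * q, a' * q)"
      using q by simp
  qed
  also have "\<dots> = (corner k q g * corner k q x) $$ (a, a')"
    using a by (simp add: corner_def scalar_prod_def lessThan_atLeast0)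
  finally show "corner k q (g * x) $$ (a, a') = (corner k q g * corner k q x) $$ (a, a')" .
qed (auto simp: corner_def)

lemma corner_kron_one:
  fixes h :: "'a::field mat"
  assumes "h \<in> carrier_mat k k" "q > 0"
  shows "corner k q (kron h (1\<^sub>m q)) = h"
proof (rule eq_matI)
  fix a b assume "a < dim_row h" "b < dim_col h"
  then have ab: "a < k" "b < k" using assms by auto
  then have "a * q < k * q" "b * q < k * q" using assms(2) by auto
  then show "corner k q (kron h (1\<^sub>m q)) $$ (a, b) = h $$ (a, b)"
    using ab assms by (simp add: corner_def kron_index[of _ k _ q])
qed (use assms in \<open>auto simp: corner_def\<close>)

lemma corner_smult:
  fixes g :: "'a::field mat"
  assumes "g \<in> carrier_mat (k * q) (k * q)" "q > 0"
  shows "corner k q (c \<cdot>\<^sub>m g) = c \<cdot>\<^sub>m corner k q g"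
  using assms by (intro eq_matI) (auto simp: corner_def)

lemma corner_commutes_kron:
  fixes g h :: "'a::field mat"
  assumes g: "g \<in> carrier_mat (k * q) (k * q)" and h: "h \<in> carrier_mat k k" and q: "q > 0"
    and blocks: "\<And>i j. i < k * q \<Longrightarrow> j < k * q \<Longrightarrow> i mod q \<noteq> j mod q \<Longrightarrow> g $$ (i, j) = 0"
    and c: "g * kron h (1\<^sub>m q) = c \<cdot>\<^sub>m (kron h (1\<^sub>m q) * g)"
  shows "corner k q g * h = c \<cdot>\<^sub>m (h * corner k q g)"
proof -
  have K: "kron h (1\<^sub>m q) \<in> carrier_mat (k * q) (k * q)" using h by (simp add: kron_carrier)
  have "corner k q g * h = corner k q (g * kron h (1\<^sub>m q))"
    using corner_mult[OF g K q blocks] corner_kron_one[OF h q] by simp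
  also have "\<dots> = c \<cdot>\<^sub>m corner k q (kron h (1\<^sub>m q) * g)"
    unfolding c using corner_smult[OF mult_carrier_mat[OF K g] q] .
  also have "corner k q (kron h (1\<^sub>m q) * g) = h * corner k q g"
    \<comment> \<open>Here the left factor is the Kronecker product, which has block form because of
      its identity factor.\<close>
    by (subst corner_mult[OF K g q])
      (use h in \<open>auto simp: corner_kron_one[OF h q] kron_index[of _ k _ q] div_mod_block\<close>)
  finally show ?thesis .
qed

text \<open>The corner of an inverse of \<open>g\<close> is a right inverse of the corner of
  \<open>g\<close>.\<close>

lemma corner_in_GLm:
  fixes g :: "'a::field mat"
  assumes g: "g \<in> GLm (k * q)" and q: "q > 0"
    and blocks: "\<And>i j. i < k * q \<Longrightarrow> j < k * q \<Longrightarrow> i mod q \<noteq> j mod q \<Longrightarrow> g $$ (i, j) = 0"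
  shows "corner k q g \<in> GLm k"
proof -
  obtain g' where g': "g' \<in> GLm (k * q)" "g * g' = 1\<^sub>m (k * q)" using g by (rule GLm_inverse)
  have "corner k q g * corner k q g' = corner k q (kron (1\<^sub>m k) (1\<^sub>m q))"
    using corner_mult[OF GLm_carrier[OF g] GLm_carrier[OF g'(1)] q blocks] g' by (simp add: kron_one)
  then have "corner k q g * corner k q g' = 1\<^sub>m k"
    using corner_kron_one[of "1\<^sub>m k" k q] q by simp
  then show ?thesis
    by (intro right_inverse_in_GLm(1)[of _ _ "corner k q g'"]) (auto simp: corner_def)
qed

subsection \<open>The matrices $A_s$ and $B_s$\<close>

text \<open>In base \<open>p\<close>, \<open>sigma_perm\<close> raises digit \<open>s\<close>
  cyclically without a carry: subtracting \<open>(p - 1) * p ^ s\<close> resets the top digit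
  \<open>p - 1\<close> to 0. Here \<open>x\<close> collects the higher and \<open>z\<close> the
  lower digits.\<close>

lemma sigma_perm_digits:
  assumes "y < p" "z < p ^ s"
  shows "sigma_perm p s (p ^ Suc s * x + p ^ s * y + z) = p ^ Suc s * x + p ^ s * (Suc y mod p) + z"
proof -
  have less: "p ^ s * y + z < p ^ Suc s"
    using block_index_less[OF assms] by (simp add: mult.commute)
  have "(p ^ Suc s * x + p ^ s * y + z) mod p ^ Suc s = (p ^ s * y + z) mod p ^ Suc s"
    by (metis mod_mult_self4 add.assoc)
  also have "\<dots> = p ^ s * y + z"
    using less by (rule mod_less)
  finally have m: "(p ^ Suc s * x + p ^ s * y + z) mod p ^ Suc s = p ^ s * y + z" .
  show ?thesis
  proof (cases "Suc y < p")
    case True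
    have "y * p ^ s + z < (p - 1) * p ^ s"
      using True assms(2) by (intro block_index_less) auto
    then have "(p ^ Suc s * x + p ^ s * y + z) mod p ^ (s + 1) < (p - 1) * p ^ s"
      using m by (simp add: mult.commute)
    then show ?thesis using True by (simp add: sigma_perm_def)
  next
    case False
    then have y: "Suc y = p" using assms(1) by simp
    then have y': "(p - 1) * p ^ s = p ^ s * y" by (metis diff_Suc_1 mult.commute)
    have "\<not> (p ^ Suc s * x + p ^ s * y + z) mod p ^ (s + 1) < (p - 1) * p ^ s"
      unfolding y' using m by simp
    then show ?thesis unfolding sigma_perm_def y' using y by simp
  qed
qed

lemma digits_decomposition:
  fixes b :: nat
  shows "b = p ^ Suc s * (b div p ^ Suc s) + p ^ s * (b div p ^ s mod p) + b mod p ^ s"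
proof -
  have "b = p ^ Suc s * (b div p ^ Suc s) + b mod p ^ Suc s" by simp
  also have "b mod p ^ Suc s = p ^ s * (b div p ^ s mod p) + b mod p ^ s"
    by (metis mod_mult2_eq power_Suc2)
  finally show ?thesis by simp
qed

lemma digits_of_sum:
  fixes x y z p s :: nat
  assumes "y < p" "z < p ^ s"
  defines "b \<equiv> p ^ Suc s * x + p ^ s * y + z"
  shows "b div p ^ Suc s = x" "b div p ^ s = p * x + y" "b mod p ^ s = z"
proof -
  have b: "b = p ^ s * (p * x + y) + z" by (simp add: b_def algebra_simps)
  have nz: "p ^ s \<noteq> 0" using assms(2) by linarith
  show 2: "b div p ^ s = p * x + y"
    unfolding b by (simp only: div_mult_self4[OF nz] div_less[OF assms(2)] add_0_right)
  show "b mod p ^ s = z"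
    unfolding b by (simp only: mod_mult_self4 mod_less[OF assms(2)])
  have "b div p ^ Suc s = (p * x + y) div p"
    by (metis 2 div_mult2_eq power_Suc2)
  then show "b div p ^ Suc s = x" using assms(1) by simp
qed

lemma sigma_perm_facts:
  assumes "p > 0"
  shows "sigma_perm p s b div p ^ Suc s = b div p ^ Suc s"
    "sigma_perm p s b div p ^ s = p * (b div p ^ Suc s) + Suc (b div p ^ s mod p) mod p"
    "sigma_perm p s b mod p ^ s = b mod p ^ s"
proof -
  let ?x = "b div p ^ Suc s" and ?y = "b div p ^ s mod p" and ?z = "b mod p ^ s"
  have lt: "?y < p" "?z < p ^ s" "Suc ?y mod p < p" using assms by auto
  have eq: "sigma_perm p s b = p ^ Suc s * ?x + p ^ s * (Suc ?y mod p) + ?z"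
    using sigma_perm_digits[OF lt(1,2), of ?x] digits_decomposition[of b p s] by simp
  show "sigma_perm p s b div p ^ Suc s = ?x"
    "sigma_perm p s b div p ^ s = p * ?x + Suc ?y mod p" "sigma_perm p s b mod p ^ s = ?z"
    unfolding eq using digits_of_sum[OF lt(3,2)] by blast+
qed

text \<open>Only digit \<open>s\<close> changes, and \<open>s < r\<close>, so the quotient by
  \<open>p ^ r\<close> remains 0.\<close>

lemma sigma_perm_less:
  assumes "p > 0" "s < r" "b < p ^ r"
  shows "sigma_perm p s b < p ^ r"
proof -
  have r: "p ^ r = p ^ Suc s * p ^ (r - Suc s)" using assms(2) by (metis power_add le_add_diff_inverse Suc_leI)
  have "sigma_perm p s b div p ^ r = b div p ^ r"
    unfolding r div_mult2_eq sigma_perm_facts(1)[OF assms(1)] ..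
  then show ?thesis using assms by (simp add: div_eq_0_iff)
qed

lemma Suc_mod_inject: "Suc a mod p = Suc b mod p \<Longrightarrow> a mod p = b mod p"
proof -
  assume "Suc a mod p = Suc b mod p"
  then have "int (Suc a) mod int p = int (Suc b) mod int p" by (metis of_nat_mod)
  then have "int a mod int p = int b mod int p"
    by (metis mod_diff_left_eq add_diff_cancel_left' of_nat_Suc)
  then show ?thesis by (metis of_nat_eq_iff of_nat_mod)
qed

lemma inj_sigma_perm:
  assumes p: "p > 0"
  shows "inj (sigma_perm p s)"
proof (rule injI)
  fix b c assume eq: "sigma_perm p s b = sigma_perm p s c"
  note f = sigma_perm_facts[OF p, of s]
  have x: "b div p ^ Suc s = c div p ^ Suc s" and z: "b mod p ^ s = c mod p ^ s"
    using f(1,3)[of b] f(1,3)[of c] eq by simp_all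
  have "Suc (b div p ^ s mod p) mod p = Suc (c div p ^ s mod p) mod p"
    using f(2)[of b] f(2)[of c] eq x by simp
  from Suc_mod_inject[OF this] have y: "b div p ^ s mod p = c div p ^ s mod p" by simp
  show "b = c"
    using digits_decomposition[of b p s] unfolding x y z digits_decomposition[of c p s, symmetric] .
qed

lemma power_mod_exponent:
  fixes \<beta> :: "'a::monoid_mult"
  assumes "\<beta> ^ p = 1"
  shows "\<beta> ^ (m mod p) = \<beta> ^ m"
proof -
  have "\<beta> ^ m = \<beta> ^ (p * (m div p) + m mod p)" by simp
  also have "\<dots> = \<beta> ^ (m mod p)" unfolding power_add power_mult assms by simp
  finally show ?thesis ..
qed

text \<open>Since \<open>\<beta> ^ p = 1\<close>, the power depends only on digit \<open>u\<close>
  of the index, and \<open>sigma_perm\<close> moves only digit \<open>s\<close>. The wrap-around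
  from \<open>p - 1\<close> to 0 is invisible for the same reason.\<close>

lemma root_power_sigma_perm:
  fixes \<beta> :: "'a::field"
  assumes p: "p > 0" and b1: "\<beta> ^ p = 1"
  shows "\<beta> ^ (sigma_perm p s b div p ^ u) = (if u = s then \<beta> else 1) * \<beta> ^ (b div p ^ u)"
proof -
  note f = sigma_perm_facts[OF p, of s b]
  consider "u < s" | "u = s" | "s < u" by linarith
  then show ?thesis
  proof cases
    case 1
    \<comment> \<open>As \<open>u < s\<close>, dropping the digits from place \<open>s\<close> on
      changes the exponent by a multiple of \<open>p\<close>; the digits that remain are untouched
      by \<open>sigma_perm\<close>.\<close>
    have "\<beta> ^ (c div p ^ u) = \<beta> ^ (c mod p ^ s div p ^ u)" for c
    proof -
      have s: "p ^ s = p ^ u * (p * p ^ (s - Suc u))" using 1 by (simp flip: power_Suc power_add)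
      have "c = p ^ s * (c div p ^ s) + c mod p ^ s" by simp
      also have "\<dots> = p ^ u * (p * p ^ (s - Suc u) * (c div p ^ s)) + c mod p ^ s"
        by (subst (1) s) (simp add: mult.assoc)
      finally have "c div p ^ u = p * p ^ (s - Suc u) * (c div p ^ s) + c mod p ^ s div p ^ u"
        using p by (metis div_mult_self4 add.commute power_eq_0_iff less_numeral_extra(3))
      then show ?thesis using b1 by (simp add: power_add power_mult mult.assoc)
    qed
    from this[of b] this[of "sigma_perm p s b"] show ?thesis using f(3) 1 by simp
  next
    case 2
    have "\<beta> ^ (sigma_perm p s b div p ^ s) = \<beta> ^ (Suc (b div p ^ s mod p) mod p)"
      unfolding f(2) using b1 by (simp add: power_add power_mult)
    also have "\<dots> = \<beta> * \<beta> ^ (b div p ^ s mod p)"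
      by (simp add: power_mod_exponent[OF b1])
    also have "\<dots> = \<beta> * \<beta> ^ (b div p ^ s)"
      by (simp add: power_mod_exponent[OF b1])
    finally show ?thesis using 2 by simp
  next
    case 3
    then have "p ^ u = p ^ Suc s * p ^ (u - Suc s)" by (metis power_add le_add_diff_inverse Suc_leI)
    then have "sigma_perm p s b div p ^ u = b div p ^ u" by (simp only: div_mult2_eq f(1))
    then show ?thesis using 3 by simp
  qed
qed

lemma root_power_eq_imp:
  fixes \<beta> :: "'a::field"
  assumes p: "p > 0" and b1: "\<beta> ^ p = 1" and prim: "\<forall>i. 0 < i \<and> i < p \<longrightarrow> \<beta> ^ i \<noteq> 1"
    and eq: "\<beta> ^ x = \<beta> ^ y"
  shows "x mod p = y mod p"
proof -
  have "\<not> i < j" if "i < p" "j < p" "\<beta> ^ i = \<beta> ^ j" for i j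
  proof
    assume "i < j"
    then have "\<beta> ^ j = \<beta> ^ i * \<beta> ^ (j - i)" by (simp flip: power_add)
    moreover have "\<beta> \<noteq> 0" using b1 p by (metis power_0_left zero_neq_one less_numeral_extra(3))
    ultimately have "\<beta> ^ (j - i) = 1" using that(3) by simp
    then show False using prim \<open>i < j\<close> that(2) by auto
  qed
  moreover have "\<beta> ^ (x mod p) = \<beta> ^ (y mod p)" using eq by (simp add: power_mod_exponent[OF b1])
  ultimately show ?thesis using p by (metis mod_less_divisor linorder_neqE_nat)
qed

text \<open>The joint eigenvalues of \<open>A_0\<close>, ..., \<open>A_(r-1)\<close> are pairwise
  distinct: primitivity of \<open>\<beta>\<close> lets the s-th one reveal digit \<open>s\<close>,
  and the digits are collected from the lowest upwards.\<close>

lemma root_powers_determine_index: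
  fixes \<beta> :: "'a::field"
  assumes p: "p > 0" and b1: "\<beta> ^ p = 1" and prim: "\<forall>i. 0 < i \<and> i < p \<longrightarrow> \<beta> ^ i \<noteq> 1"
    and eq: "\<And>s. s < r \<Longrightarrow> \<beta> ^ (b div p ^ s) = \<beta> ^ (c div p ^ s)"
    and bc: "b < p ^ r" "c < p ^ r"
  shows "b = c"
proof -
  have "b mod p ^ s = c mod p ^ s" if "s \<le> r" for s
    using that
  proof (induction s)
    case (Suc s)
    have "b div p ^ s mod p = c div p ^ s mod p"
      using root_power_eq_imp[OF p b1 prim eq] Suc.prems by simp
    then show ?case using Suc by (simp add: mod_mult2_eq power_Suc2 del: power_Suc)
  qed simp
  from this[of r] show ?thesis using bc by simp
qed

section \<open>Invertibility and commutation of the generators\<close>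

lemma Amat_carrier: "Amat p r \<beta> s \<in> carrier_mat (p ^ r) (p ^ r)"
  by (simp add: Amat_def)

lemma Bmat_carrier: "Bmat p r s \<in> carrier_mat (p ^ r) (p ^ r)"
  by (simp add: Bmat_def)

lemma Amat_mat_diag: "Amat p r \<beta> s = mat_diag (p ^ r) (\<lambda>i. \<beta> ^ (i div p ^ s))"
  by (auto simp: Amat_def mat_diag_def intro!: eq_matI)

lemma Amat_in_GLm:
  fixes \<beta> :: "'a::field"
  assumes "\<beta> \<noteq> 0"
  shows "Amat p r \<beta> s \<in> GLm (p ^ r)"
proof (rule right_inverse_in_GLm(1)[OF Amat_carrier Amat_carrier])
  show "Amat p r \<beta> s * Amat p r (inverse \<beta>) s = 1\<^sub>m (p ^ r)"
    unfolding Amat_mat_diag mat_diag_diag using assms by (simp flip: power_mult_distrib)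
qed

text \<open>The inverse of a permutation matrix is its transpose; \<open>s < r\<close> keeps the
  permutation within the index range.\<close>

lemma Bmat_in_GLm:
  assumes p: "p > 0" and s: "s < r"
  shows "(Bmat p r s :: 'a::field mat) \<in> GLm (p ^ r)"
proof (rule right_inverse_in_GLm(1)[OF Bmat_carrier])
  let ?B = "Bmat p r s :: 'a mat"
  show "transpose_mat ?B \<in> carrier_mat (p ^ r) (p ^ r)" using Bmat_carrier by simp
  show "?B * transpose_mat ?B = 1\<^sub>m (p ^ r)"
  proof (rule eq_matI)
    fix i j assume "i < dim_row (1\<^sub>m (p ^ r))" "j < dim_col (1\<^sub>m (p ^ r))"
    then have ij: "i < p ^ r" "j < p ^ r" by auto
    have "(?B * transpose_mat ?B) $$ (i, j) =
        (\<Sum>l<p ^ r. (if sigma_perm p s i = l then 1 else 0) * (if sigma_perm p s j = l then 1 else 0))"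
      using ij by (simp add: Bmat_def scalar_prod_def lessThan_atLeast0)
    also have "\<dots> = (\<Sum>l<p ^ r. if l = sigma_perm p s i then if i = j then 1 else 0 else 0)"
      using inj_sigma_perm[OF p, of s] by (intro sum.cong) (auto dest: injD)
    also have "\<dots> = (if i = j then 1 else 0)"
      using sigma_perm_less[OF p s ij(1)] by simp
    finally show "(?B * transpose_mat ?B) $$ (i, j) = (1\<^sub>m (p ^ r) :: 'a mat) $$ (i, j)"
      using ij by simp
  qed (auto simp: Bmat_def)
qed

text \<open>One product scales the columns of \<open>Bmat\<close> and the other its rows; at a
  nonzero entry the column is the \<open>sigma_perm\<close> image of the row, so the two factors
  differ as in \<open>root_power_sigma_perm\<close>.\<close>

lemma Bmat_Amat_commute:
  fixes \<beta> :: "'a::field"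
  assumes p: "p > 0" and b1: "\<beta> ^ p = 1"
  shows "Bmat p r s * Amat p r \<beta> u = (if u = s then \<beta> else 1) \<cdot>\<^sub>m (Amat p r \<beta> u * Bmat p r s)"
  unfolding Amat_mat_diag mat_diag_mult_left[OF Bmat_carrier] mat_diag_mult_right[OF Bmat_carrier]
  by (intro eq_matI) (auto simp: Bmat_def root_power_sigma_perm[OF p b1])

section \<open>Commutation with the generators in size \<open>k * p ^ r\<close>\<close>

abbreviation "bigA p r k \<beta> s \<equiv> kron (1\<^sub>m k) (Amat p r \<beta> s)"
abbreviation "bigB p r k s \<equiv> kron (1\<^sub>m k) (Bmat p r s)"

lemma bigB_bigA_commute:
  fixes \<beta> :: "'a::field"
  assumes p: "p > 0" and b1: "\<beta> ^ p = 1"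
  shows "bigB p r k s * bigA p r k \<beta> u =
    (if u = s then \<beta> else 1) \<cdot>\<^sub>m (bigA p r k \<beta> u * bigB p r k s)"
  by (simp add: kron_mult[OF one_carrier_mat Bmat_carrier one_carrier_mat Amat_carrier]
      kron_mult[OF one_carrier_mat Amat_carrier one_carrier_mat Bmat_carrier]
      kron_smult_right[OF one_carrier_mat mult_carrier_mat[OF Amat_carrier Bmat_carrier]]
      Bmat_Amat_commute[OF p b1] del: smult_carrier_mat split del: if_split)

lemma bigB_kron_commute:
  assumes h: "(h :: 'a::field mat) \<in> carrier_mat k k"
  shows "bigB p r k s * kron h (1\<^sub>m (p ^ r)) = kron h (1\<^sub>m (p ^ r)) * bigB p r k s"
  using h by (simp add: kron_mult[OF one_carrier_mat Bmat_carrier h one_carrier_mat]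
      kron_mult[OF h one_carrier_mat one_carrier_mat Bmat_carrier]
      left_mult_one_mat[OF Bmat_carrier] right_mult_one_mat[OF Bmat_carrier])

lemma bigA_mat_diag: "bigA p r k \<beta> s = mat_diag (k * p ^ r) (\<lambda>i. \<beta> ^ (i mod p ^ r div p ^ s))"
proof (rule eq_matI)
  let ?D = "mat_diag (k * p ^ r) (\<lambda>i. \<beta> ^ (i mod p ^ r div p ^ s))"
  fix i j assume "i < dim_row ?D" "j < dim_col ?D"
  then have ij: "i < k * p ^ r" "j < k * p ^ r" by (auto simp: mat_diag_def)
  have "i = j \<longleftrightarrow> i div p ^ r = j div p ^ r \<and> i mod p ^ r = j mod p ^ r" by (metis div_mult_mod_eq)
  then show "bigA p r k \<beta> s $$ (i, j) = ?D $$ (i, j)"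
    unfolding kron_index[OF one_carrier_mat Amat_carrier ij]
    using ij div_mod_block[OF ij(1)] div_mod_block[OF ij(2)]
    by (auto simp: Amat_def mat_diag_def)
qed (auto simp: kron_def mat_diag_def Amat_def)

lemma bigA_commute_entry:
  fixes \<beta> :: "'a::field"
  assumes g: "g \<in> carrier_mat (k * p ^ r) (k * p ^ r)"
    and c: "g * bigA p r k \<beta> s = c \<cdot>\<^sub>m (bigA p r k \<beta> s * g)"
    and ij: "i < k * p ^ r" "j < k * p ^ r" "g $$ (i, j) \<noteq> 0"
  shows "\<beta> ^ (j mod p ^ r div p ^ s) = c * \<beta> ^ (i mod p ^ r div p ^ s)"
proof -
  have "(g * bigA p r k \<beta> s) $$ (i, j) = (c \<cdot>\<^sub>m (bigA p r k \<beta> s * g)) $$ (i, j)" by (simp only: c)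
  then show ?thesis
    unfolding bigA_mat_diag mat_diag_mult_left[OF g] mat_diag_mult_right[OF g]
    using ij by simp
qed

text \<open>At a nonzero entry of \<open>g\<close>, the scalar is a ratio of two diagonal entries of
  \<open>bigA\<close>, so its inverse is a power of \<open>\<beta>\<close>.\<close>

lemma bigA_commute_scalar:
  fixes \<beta> :: "'a::field"
  assumes p: "p > 0" and b1: "\<beta> ^ p = 1" and n: "k * p ^ r > 0" and g: "g \<in> GLm (k * p ^ r)"
    and c: "g * bigA p r k \<beta> s = c \<cdot>\<^sub>m (bigA p r k \<beta> s * g)"
  shows "\<exists>m. c * \<beta> ^ m = 1"
proof -
  obtain i j where ij: "i < k * p ^ r" "j < k * p ^ r" "g $$ (i, j) \<noteq> 0"
    using g n by (rule GLm_nonzero_entry)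
  define x y where "x = j mod p ^ r div p ^ s" and "y = i mod p ^ r div p ^ s"
  have eq: "\<beta> ^ x = c * \<beta> ^ y"
    unfolding x_def y_def by (rule bigA_commute_entry[OF GLm_carrier[OF g] c ij])
  \<comment> \<open>The inverse of \<open>c\<close> has exponent \<open>y - x\<close>;
    \<open>(p - 1) * x\<close> stands for \<open>- x\<close> modulo \<open>p\<close>, keeping the
    exponent a natural number.\<close>
  have "c * \<beta> ^ (y + (p - 1) * x) = \<beta> ^ x * \<beta> ^ ((p - 1) * x)" by (simp add: power_add eq)
  also have "\<dots> = \<beta> ^ (p * x)" using p by (simp flip: power_add add: algebra_simps)
  finally show ?thesis using b1 by (auto simp: power_mult)
qed

lemma bigA_commute_imp_blocks:
  fixes \<beta> :: "'a::field"
  assumes p: "p > 0" and b1: "\<beta> ^ p = 1" and prim: "\<forall>i. 0 < i \<and> i < p \<longrightarrow> \<beta> ^ i \<noteq> 1"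
    and g: "g \<in> carrier_mat (k * p ^ r) (k * p ^ r)"
    and c: "\<And>s. s < r \<Longrightarrow> g * bigA p r k \<beta> s = bigA p r k \<beta> s * g"
    and ij: "i < k * p ^ r" "j < k * p ^ r" "i mod p ^ r \<noteq> j mod p ^ r"
  shows "g $$ (i, j) = 0"
proof (rule ccontr)
  assume "g $$ (i, j) \<noteq> 0"
  then have "\<beta> ^ (j mod p ^ r div p ^ s) = 1 * \<beta> ^ (i mod p ^ r div p ^ s)" if "s < r" for s
    using that c by (intro bigA_commute_entry[OF g _ ij(1,2)]) (auto simp: one_smult_mat)
  then have "j mod p ^ r = i mod p ^ r"
    using p by (intro root_powers_determine_index[OF p b1 prim, of r]) auto
  then show False using ij by simp
qed

text \<open>Multiplication by a power of $B_j$ removes the commutation scalar with $A_j$ without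
  affecting those with the other $A_s$.\<close>

lemma clear_scalars:
  fixes \<beta> :: "'a::field"
  assumes p: "p > 0" and b1: "\<beta> ^ p = 1" and n: "k * p ^ r > 0" and g: "g \<in> GLm (k * p ^ r)"
    and c: "\<And>s. s < r \<Longrightarrow> \<exists>c. g * bigA p r k \<beta> s = c \<cdot>\<^sub>m (bigA p r k \<beta> s * g)"
    and j: "j \<le> r"
  shows "\<exists>w\<in>GLm (k * p ^ r). pcls w \<in> pgen (k * p ^ r) (Bbar p r k ` {..<r}) \<and>
    (\<forall>s<r. \<exists>c. (g * w) * bigA p r k \<beta> s = c \<cdot>\<^sub>m (bigA p r k \<beta> s * (g * w)) \<and> (s < j \<longrightarrow> c = 1))"
  using j
proof (induction j)
  case 0
  have "pcls (1\<^sub>m (k * p ^ r)) \<in> pgen (k * p ^ r) (Bbar p r k ` {..<r})"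
    using pgen.gen_one by (simp add: pone_def)
  moreover have "g * 1\<^sub>m (k * p ^ r) = g" using GLm_carrier[OF g] by simp
  ultimately show ?case using c by (intro bexI[of _ "1\<^sub>m (k * p ^ r)"]) (auto simp: one_in_GLm)
next
  case (Suc j)
  let ?n = "k * p ^ r" and ?S = "Bbar p r k ` {..<r} :: 'a mat set set"
  from Suc obtain w where w: "w \<in> GLm ?n" "pcls w \<in> pgen ?n ?S"
    and wc: "\<forall>s<r. \<exists>c. (g * w) * bigA p r k \<beta> s = c \<cdot>\<^sub>m (bigA p r k \<beta> s * (g * w)) \<and> (s < j \<longrightarrow> c = 1)"
    by auto
  have jr: "j < r" using Suc.prems by simp
  have gw: "g * w \<in> GLm ?n" using g w(1) by (rule mult_in_GLm)
  from wc jr obtain d where d: "(g * w) * bigA p r k \<beta> j = d \<cdot>\<^sub>m (bigA p r k \<beta> j * (g * w))" by blast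
  \<comment> \<open>\<open>B_j\<close> commutes with \<open>A_j\<close> up to
    \<open>\<beta>\<close>, so its m-th power contributes exactly the factor that cancels
    \<open>d\<close>.\<close>
  obtain m where m: "d * \<beta> ^ m = 1" using bigA_commute_scalar[OF p b1 n gw d] by blast
  define B where "B = (bigB p r k j :: 'a mat)"
  have B: "B \<in> GLm ?n" unfolding B_def by (intro kron_in_GLm one_in_GLm Bmat_in_GLm p jr)
  have BS: "pcls (B ^\<^sub>m m) \<in> pgen ?n ?S"
    using jr by (intro pcls_pow_in_pgen B pgen.gen_base) (auto simp: B_def Bbar_def)
  have A: "bigA p r k \<beta> s \<in> carrier_mat ?n ?n" for s
    by (rule kron_carrier[OF one_carrier_mat Amat_carrier])
  have Bm: "B ^\<^sub>m m \<in> GLm ?n" using B by (rule pow_in_GLm)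
  have comm: "B ^\<^sub>m m * bigA p r k \<beta> s =
      ((if s = j then \<beta> else 1) ^ m) \<cdot>\<^sub>m (bigA p r k \<beta> s * B ^\<^sub>m m)" for s
    using scalar_commute_power[OF GLm_carrier[OF B] A bigB_bigA_commute[OF p b1, where s = j and u = s and r = r and k = k, folded B_def]] .
  show ?case
  proof (intro bexI[of _ "w * B ^\<^sub>m m"] conjI allI impI)
    show "w * B ^\<^sub>m m \<in> GLm ?n" using w(1) Bm by (rule mult_in_GLm)
    show "pcls (w * B ^\<^sub>m m) \<in> pgen ?n ?S"
      using pgen.gen_mul[OF w(2) BS] pmul_pcls[OF GLm_carrier[OF w(1)] GLm_carrier[OF Bm]] by simp
    fix s assume s: "s < r"
    with wc obtain c where c: "(g * w) * bigA p r k \<beta> s = c \<cdot>\<^sub>m (bigA p r k \<beta> s * (g * w))"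
      and c1: "s < j \<longrightarrow> c = 1" by blast
    \<comment> \<open>The scalar for \<open>s\<close> was chosen anew; uniqueness identifies it with
      the \<open>d\<close> from which the exponent was computed.\<close>
    have c': "c = d" if "s = j"
    proof -
      have "c \<cdot>\<^sub>m (bigA p r k \<beta> j * (g * w)) = d \<cdot>\<^sub>m (bigA p r k \<beta> j * (g * w))"
        using c d that by simp
      moreover have "\<beta> \<noteq> 0" using b1 p by (metis power_0_left zero_neq_one less_numeral_extra(3))
      then have "bigA p r k \<beta> j * (g * w) \<in> GLm ?n"
        by (intro mult_in_GLm gw kron_in_GLm one_in_GLm Amat_in_GLm)
      ultimately show ?thesis using GLm_smult_cancel n by blast
    qed
    have assoc: "g * (w * B ^\<^sub>m m) = (g * w) * B ^\<^sub>m m"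
      using GLm_carrier[OF g] GLm_carrier[OF w(1)] GLm_carrier[OF Bm]
      by (simp add: assoc_mult_mat[of _ ?n ?n _ ?n _ ?n])
    have "(g * (w * B ^\<^sub>m m)) * bigA p r k \<beta> s =
        (c * (if s = j then \<beta> else 1) ^ m) \<cdot>\<^sub>m (bigA p r k \<beta> s * (g * (w * B ^\<^sub>m m)))"
      unfolding assoc
      by (rule scalar_commute_mult[OF GLm_carrier[OF gw] GLm_carrier[OF Bm] A c comm])
    moreover have "c * (if s = j then \<beta> else 1) ^ m = 1" if "s < Suc j"
      using that c1 c' m by (cases "s = j") auto
    ultimately show "\<exists>c. (g * (w * B ^\<^sub>m m)) * bigA p r k \<beta> s =
        c \<cdot>\<^sub>m (bigA p r k \<beta> s * (g * (w * B ^\<^sub>m m))) \<and> (s < Suc j \<longrightarrow> c = 1)" by blast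
  qed
qed

text \<open>The line through 1 and g stays in the commutant of S.\<close>

lemma commuting_in_pidcomp:
  fixes g :: "'a::alg_closed_field mat"
  assumes g: "g \<in> GLm n" and S: "S \<subseteq> GLm n" and comm: "\<And>x. x \<in> S \<Longrightarrow> g * x = x * g"
  shows "pcls g \<in> pidcomp n (pcentralizer n (pcls ` S))"
proof -
  define L where "L = (\<lambda>t. 1\<^sub>m n + t \<cdot>\<^sub>m (g - 1\<^sub>m n))"
  define T where "T = {pcls (L t) | t. L t \<in> GLm n}"
  note gc = GLm_carrier[OF g]
  have "L 0 = 1\<^sub>m n" "L 1 = g" unfolding L_def using gc by (auto intro!: eq_matI)
  then have mem: "pone n \<in> T" "pcls g \<in> T"
    unfolding T_def pone_def using g one_in_GLm[of n] by (metis (mono_tags, lifting) mem_Collect_eq)+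
  have conn: "connectedin (pgl_zariski n) T"
    unfolding T_def L_def using gc by (intro connectedin_line) auto
  have "T \<subseteq> pcentralizer n (pcls ` S)"
  proof
    fix X assume "X \<in> T"
    then obtain t where t: "X = pcls (L t)" "L t \<in> GLm n" by (auto simp: T_def)
    have "pmul X (pcls x) = pmul (pcls x) X" if x: "x \<in> S" for x
    proof -
      have xc: "x \<in> carrier_mat n n" using x S GLm_carrier by blast
      have gx: "(g - 1\<^sub>m n) * x = x * (g - 1\<^sub>m n)"
        using gc xc comm[OF x] by (simp add: minus_mult_distrib_mat[of _ n n] mult_minus_distrib_mat[of _ n n])
      have d: "g - 1\<^sub>m n \<in> carrier_mat n n" using gc by auto
      have "L t * x = 1\<^sub>m n * x + (t \<cdot>\<^sub>m (g - 1\<^sub>m n)) * x"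
        unfolding L_def by (rule add_mult_distrib_mat[of _ n n _ _ n]) (use d xc in auto)
      also have "\<dots> = x * 1\<^sub>m n + x * (t \<cdot>\<^sub>m (g - 1\<^sub>m n))"
        using d xc gx by (simp add: mult_smult_assoc_mat[of _ n n _ n] mult_smult_distrib[of _ n n _ n])
      also have "\<dots> = x * L t"
        unfolding L_def by (rule mult_add_distrib_mat[of _ n n _ n, symmetric]) (use d xc in auto)
      finally show ?thesis
        unfolding t(1) using pmul_pcls[OF GLm_carrier[OF t(2)] xc] pmul_pcls[OF xc GLm_carrier[OF t(2)]]
        by simp
    qed
    then show "X \<in> pcentralizer n (pcls ` S)"
      using t by (auto simp: pcentralizer_def pcls_in_PGLm)
  qed
  then show ?thesis
    unfolding pidcomp_def connected_component_of_def using conn mem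
    by (auto simp: connectedin_subtopology)
qed

theorem theorem4p28:
  fixes p s t r k n :: nat and \<beta> :: "'a::alg_closed_field"
    and H :: "'a mat set set"
  assumes "prime p" and "odd p" and "CHAR('a) \<noteq> p"
    and "\<beta> ^ p = 1" and "\<forall>i. 0 < i \<and> i < p \<longrightarrow> \<beta> ^ i \<noteq> 1"
    and "n = p ^ s * t" and "coprime p t" and "1 \<le> s" and "1 \<le> t"
    and "1 \<le> r" and "r \<le> s" and "n = p ^ r * k"
    and "H = {pone k} \<or>
         (elem_abelian_p p k H \<and> ptoral k H \<and> connectedin (pgl_zariski k) (pcentralizer k H))"
  defines "D \<equiv> pgen n ((\<lambda>s'. Abar p r k \<beta> s') ` {..<r} \<union> tensorI (p ^ r) ` H)"
    and "Br \<equiv> pgen n ((\<lambda>s'. Bbar p r k s') ` {..<r})"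
  shows "pcentralizer n D = pgen n (pidcomp n (pcentralizer n D) \<union> (\<lambda>s'. Bbar p r k s') ` {..<r})
       \<and> pcentralizer n D = psetmul (pidcomp n (pcentralizer n D)) Br"
proof -
  have p: "p > 0" using assms(1) by (rule prime_gt_0_nat)
  have b0: "\<beta> \<noteq> 0" using assms(4) p by (metis power_0_left zero_neq_one less_numeral_extra(3))
  let ?q = "p ^ r"
  have q: "?q > 0" using p by simp
  have n: "n = k * ?q" using assms(12) by (simp add: mult.commute)
  have n0: "n > 0" using assms(6,9) p by simp
  have k0: "k > 0" using n0 n by (cases k) auto
  have HP: "H \<subseteq> PGLm k"
    using assms(13) pone_in_PGLm by (auto simp: elem_abelian_p_def psubgroup_def)
  \<comment> \<open>The same choice as inside \<open>tensorI\<close>, so the generators of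
    \<open>D\<close> are literally the classes of the matrices in \<open>S\<close> below.\<close>
  define rep where "rep X = (SOME h. h \<in> X)" for X :: "'a mat set"
  have rep: "rep X \<in> GLm k" "X = pcls (rep X)" if "X \<in> H" for X
  proof -
    have X: "X \<in> PGLm k" using that HP by blast
    then obtain A where "X = pcls A" by (rule PGLm_E)
    then have "A \<in> X" using pcls_self by simp
    then have "rep X \<in> X" unfolding rep_def by (rule someI)
    then show "rep X \<in> GLm k" "X = pcls (rep X)" using mem_PGLm_class[OF X] by blast+
  qed
  define S where "S = bigA p r k \<beta> ` {..<r} \<union> (\<lambda>X. kron (rep X) (1\<^sub>m ?q)) ` H"
  define Bs where "Bs = (\<lambda>s'. Bbar p r k s' :: 'a mat set) ` {..<r}"
  define C where "C = pcentralizer n D"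
  have S: "S \<subseteq> GLm n"
    unfolding S_def n using rep b0 by (auto intro!: kron_in_GLm one_in_GLm Amat_in_GLm)
  have gens: "(\<lambda>s'. Abar p r k \<beta> s') ` {..<r} \<union> tensorI ?q ` H = pcls ` S"
    unfolding S_def Abar_def tensorI_def rep_def by (simp add: image_Un image_image)
  have SP: "pcls ` S \<subseteq> PGLm n" using S pcls_in_PGLm by blast
  have C: "C = pcentralizer n (pcls ` S)"
    unfolding C_def D_def gens by (rule pcentralizer_pgen[OF SP])
  have Csub: "psubgroup n C" unfolding C by (rule psubgroup_pcentralizer[OF SP])
  have bigB: "bigB p r k j \<in> GLm n" if "j < r" for j
    unfolding n by (intro kron_in_GLm one_in_GLm Bmat_in_GLm p that)
  have BsC: "Bs \<subseteq> C"
  proof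
    fix Y assume "Y \<in> Bs"
    then obtain j where j: "j < r" "Y = pcls (bigB p r k j)" by (auto simp: Bs_def Bbar_def)
    have "\<exists>c. c \<noteq> 0 \<and> bigB p r k j * x = c \<cdot>\<^sub>m (x * bigB p r k j)" if "x \<in> S" for x
    proof -
      from that consider u where "x = bigA p r k \<beta> u" | X where "X \<in> H" "x = kron (rep X) (1\<^sub>m ?q)"
        by (auto simp: S_def)
      then show ?thesis
      proof cases
        case 1
        show ?thesis
          unfolding 1 by (rule exI, rule conjI[OF _ bigB_bigA_commute[OF p assms(4)]]) (simp add: b0)
      next
        case 2
        then show ?thesis
          using bigB_kron_commute[OF GLm_carrier[OF rep(1)[OF 2(1)]]]
          by (intro exI[of _ 1]) (simp add: one_smult_mat)
      qed
    qed
    then have "pmul Y X = pmul X Y" if "X \<in> pcls ` S" for X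
      using that S pmul_commute_iff[OF GLm_carrier[OF bigB[OF j(1)]] GLm_carrier] unfolding j(2)
      by blast
    then show "Y \<in> C"
      unfolding C pcentralizer_def using pcls_in_PGLm[OF bigB[OF j(1)]] j(2) by blast
  qed
  then have BrC: "Br \<subseteq> C"
    unfolding Br_def Bs_def[symmetric] using Csub by (rule pgen_subset)
  have id: "pidcomp n C \<subseteq> C"
    unfolding pidcomp_def using connected_component_of_subset_topspace by fastforce
  have main: "C \<subseteq> psetmul (pidcomp n C) Br"
  proof
    fix G assume G: "G \<in> C"
    then obtain g where g: "g \<in> GLm n" "G = pcls g" by (auto simp: C pcentralizer_def PGLm_def)
    have "\<exists>c. g * bigA p r k \<beta> u = c \<cdot>\<^sub>m (bigA p r k \<beta> u * g)" if "u < r" for u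
    proof -
      have x: "bigA p r k \<beta> u \<in> S" using that by (auto simp: S_def)
      then have "pmul (pcls g) (pcls (bigA p r k \<beta> u)) = pmul (pcls (bigA p r k \<beta> u)) (pcls g)"
        using G g(2) unfolding C pcentralizer_def by blast
      then show ?thesis
        using pmul_commute_iff[OF GLm_carrier[OF g(1)] GLm_carrier] x S by blast
    qed
    \<comment> \<open>Taking the induction bound to be \<open>r\<close> makes the scalars with all
      the \<open>A_s\<close> equal to 1.\<close>
    from clear_scalars[OF p assms(4) n0[unfolded n] g(1)[unfolded n] this, of r]
    obtain w where w: "w \<in> GLm n" "pcls w \<in> Br"
      and wA: "\<forall>u<r. (g * w) * bigA p r k \<beta> u = 1 \<cdot>\<^sub>m (bigA p r k \<beta> u * (g * w))"
      unfolding n Br_def by auto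
    define g1 where "g1 = g * w"
    have g1: "g1 \<in> GLm n" unfolding g1_def using g(1) w(1) by (rule mult_in_GLm)
    have g1A: "g1 * bigA p r k \<beta> u = bigA p r k \<beta> u * g1" if "u < r" for u
      using wA that by (simp add: g1_def one_smult_mat)
    have pg1: "pcls g1 = pmul G (pcls w)"
      unfolding g1_def g(2) using pmul_pcls[OF GLm_carrier[OF g(1)] GLm_carrier[OF w(1)]] by simp
    have g1C: "pcls g1 \<in> C"
      unfolding pg1 using Csub G w(2) BrC by (auto simp: psubgroup_def)
    have blocks: "g1 $$ (i, j) = 0" if "i < k * ?q" "j < k * ?q" "i mod ?q \<noteq> j mod ?q" for i j
      using bigA_commute_imp_blocks[OF p assms(4,5) GLm_carrier[OF g1, unfolded n] g1A that] .
    define g0 where "g0 = corner k ?q g1"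
    have g0: "g0 \<in> GLm k"
      unfolding g0_def using g1[unfolded n] q blocks by (rule corner_in_GLm)
    \<comment> \<open>The same c serves both equations, so a conclusion about the small matrix
      \<open>g0\<close> carries over to \<open>g1\<close>.\<close>
    have hcomm: "\<exists>c. c \<noteq> 0 \<and> g1 * kron (rep X) (1\<^sub>m ?q) = c \<cdot>\<^sub>m (kron (rep X) (1\<^sub>m ?q) * g1) \<and>
        g0 * rep X = c \<cdot>\<^sub>m (rep X * g0)" if X: "X \<in> H" for X
    proof -
      have x: "kron (rep X) (1\<^sub>m ?q) \<in> S" using X by (auto simp: S_def)
      then have "pmul (pcls g1) (pcls (kron (rep X) (1\<^sub>m ?q))) =
          pmul (pcls (kron (rep X) (1\<^sub>m ?q))) (pcls g1)"
        using g1C unfolding C pcentralizer_def by blast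
      then obtain c where c: "c \<noteq> 0" "g1 * kron (rep X) (1\<^sub>m ?q) = c \<cdot>\<^sub>m (kron (rep X) (1\<^sub>m ?q) * g1)"
        using pmul_commute_iff[OF GLm_carrier[OF g1] GLm_carrier] x S by blast
      then show ?thesis
        using corner_commutes_kron[OF GLm_carrier[OF g1, unfolded n] GLm_carrier[OF rep(1)[OF X]] q blocks]
        unfolding g0_def by blast
    qed
    have g0C: "pcls g0 \<in> pcentralizer k H"
    proof -
      have "pmul (pcls g0) X = pmul X (pcls g0)" if X: "X \<in> H" for X
        using pmul_commute_iff[OF GLm_carrier[OF g0] GLm_carrier[OF rep(1)[OF X]]] hcomm[OF X]
          rep(2)[OF X] by auto
      then show ?thesis using pcls_in_PGLm[OF g0] by (auto simp: pcentralizer_def)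
    qed
    have exact: "g0 * rep X = rep X * g0" if X: "X \<in> H" for X
      using assms(13)
    proof
      \<comment> \<open>The chosen representative need not be the identity matrix, but it is a
        scalar matrix and so commutes exactly.\<close>
      assume "H = {pone k}"
      then have "pcls (rep X) = pcls (1\<^sub>m k)" using X rep(2)[OF X] by (simp add: pone_def)
      then obtain c where c: "rep X = c \<cdot>\<^sub>m 1\<^sub>m k" using pcls_eq_iff by blast
      show ?thesis
        unfolding c using GLm_carrier[OF g0]
        by (simp add: mult_smult_distrib[of _ k k _ k] mult_smult_assoc_mat[of _ k k _ k])
    next
      assume "elem_abelian_p p k H \<and> ptoral k H \<and> connectedin (pgl_zariski k) (pcentralizer k H)"
      then show ?thesis
        using connected_centralizer_commutes[OF _ k0 HP rep(1)[OF X] _ g0 g0C] rep(2)[OF X] X by simp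
    qed
    have "g1 * x = x * g1" if x: "x \<in> S" for x
    proof -
      from x consider u where "u < r" "x = bigA p r k \<beta> u"
        | X where "X \<in> H" "x = kron (rep X) (1\<^sub>m ?q)"
        by (auto simp: S_def)
      then show ?thesis
      proof cases
        case 1
        then show ?thesis using g1A by simp
      next
        case 2
        then obtain c where c: "g1 * x = c \<cdot>\<^sub>m (x * g1)" "g0 * rep X = c \<cdot>\<^sub>m (rep X * g0)"
          using hcomm by blast
        \<comment> \<open>Exact commutation of the block forces the shared scalar to be 1.\<close>
        then have "c \<cdot>\<^sub>m (rep X * g0) = 1 \<cdot>\<^sub>m (rep X * g0)"
          using exact[OF 2(1)] by (simp add: one_smult_mat)
        then have "c = 1" by (rule GLm_smult_cancel[OF mult_in_GLm[OF rep(1)[OF 2(1)] g0] k0])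
        then show ?thesis using c(1) by (simp add: one_smult_mat)
      qed
    qed
    then have comp: "pcls g1 \<in> pidcomp n C"
      unfolding C by (rule commuting_in_pidcomp[OF g1 S])
    have GP: "G \<in> PGLm n" and wP: "pcls w \<in> PGLm n" using g w(1) by (simp_all add: pcls_in_PGLm)
    \<comment> \<open>The correction by \<open>w\<close> is undone on the right, which puts the
      identity component first and \<open>Br\<close> second.\<close>
    have "G = pmul (pcls g1) (pinv n (pcls w))"
      unfolding pg1 using GP wP pinv_in_PGLm[OF wP] by (simp add: pmul_assoc[of _ n] pmul_pone)
    moreover have "pinv n (pcls w) \<in> Br" using w(2) unfolding Br_def by (rule pgen.gen_inv)
    ultimately show "G \<in> psetmul (pidcomp n C) Br" using comp by (auto simp: psetmul_def)
  qed
  \<comment> \<open>The inclusions close a cycle from \<open>C\<close> to the product, to the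
    generated group and back to \<open>C\<close>, which gives both equalities at once.\<close>
  have "psetmul (pidcomp n C) Br \<subseteq> C"
    using id BrC Csub unfolding psetmul_def psubgroup_def by blast
  moreover have "psetmul (pidcomp n C) Br \<subseteq> pgen n (pidcomp n C \<union> Bs)"
    using pgen_mono[of Bs "pidcomp n C \<union> Bs" n]
    unfolding psetmul_def Br_def Bs_def[symmetric] by (blast intro: pgen.gen_mul pgen.gen_base)
  moreover have "pgen n (pidcomp n C \<union> Bs) \<subseteq> C"
    using id BsC Csub by (intro pgen_subset) auto
  ultimately show ?thesis
    using main unfolding C_def[symmetric] Bs_def[symmetric] by blast
qed

end
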